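(* There is an algorithm that solves the Constrained $k$-near Chain Editing problem in time $O(n^3 k^{2k+2})$, where $n=|S|+|Q|$.
   Context: The input is a bipartite graph $G=(S\cup Q,E)$ (students $S$, questions $Q$; $sq\in E$ means student $s$ answered question $q$ correctly), a bijection $\alpha:S\to\{1,\dots,|S|\}$ (initial student ordering), a positive integer $k$, and a fixed bijection $\beta:Q\to\{1,\dots,|Q|\}$ (question ordering, from easiest to hardest). For a vertex $x$, $N(x)$ denotes its neighborhood. An ordering (bijection) $\pi:S\to\{1,\dots,|S|\}$ is nested if $\pi(s_1)\ge \pi(s_2)$ implies $N(s_1)\supseteq N(s_2)$. The ordering $\beta$ satisfies the interval property if for every $s\in S$, $N(s)=\{\beta^{-1}(1),\dots,\beta^{-1}(j)\}$ for some $j\in\{0,\dots,|Q|\}$. An edge edit is the addition or deletion of a student–question pair. The Constrained $k$-near Chain Editing problem asks for a minimum-size set of edge edits such that in the edited graph there is a nested student ordering $\pi$ with $\pi(s)\in[\alpha(s)-k,\alpha(s)+k]$ for all $s\in S$, and the given question ordering $\beta$ satisfies the interval property. *)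

theory Defs
  imports Main
begin

section \<open>The editing problem\<close>

text \<open>
  A bipartite graph on students \<open>S\<close> and questions \<open>Q\<close> is given by its edge set
  \<open>E \<subseteq> S \<times> Q\<close>.
\<close>

definition nbhd :: "('s \<times> 'q) set \<Rightarrow> 's \<Rightarrow> 'q set" where
  "nbhd E s = {q. (s, q) \<in> E}"

definition is_ordering :: "'a set \<Rightarrow> ('a \<Rightarrow> nat) \<Rightarrow> bool" where
  "is_ordering A f \<longleftrightarrow> bij_betw f A {1..card A}"

definition nested :: "'s set \<Rightarrow> ('s \<times> 'q) set \<Rightarrow> ('s \<Rightarrow> nat) \<Rightarrow> bool" where
  "nested S E \<pi> \<longleftrightarrow>
     (\<forall>s\<^sub>1\<in>S. \<forall>s\<^sub>2\<in>S. \<pi> s\<^sub>1 \<ge> \<pi> s\<^sub>2 \<longrightarrow> nbhd E s\<^sub>1 \<supseteq> nbhd E s\<^sub>2)"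

definition interval_property ::
    "'s set \<Rightarrow> 'q set \<Rightarrow> ('s \<times> 'q) set \<Rightarrow> ('q \<Rightarrow> nat) \<Rightarrow> bool" where
  "interval_property S Q E \<beta> \<longleftrightarrow>
     (\<forall>s\<in>S. \<exists>j\<in>{0..card Q}. nbhd E s = inv_into Q \<beta> ` {1..j})"

definition near :: "'s set \<Rightarrow> nat \<Rightarrow> ('s \<Rightarrow> nat) \<Rightarrow> ('s \<Rightarrow> nat) \<Rightarrow> bool" where
  "near S k \<alpha> \<pi> \<longleftrightarrow>
     (\<forall>s\<in>S. int (\<pi> s) \<in> {int (\<alpha> s) - int k .. int (\<alpha> s) + int k})"

text \<open>A set \<open>F\<close> of edits toggles the pairs it contains.\<close>

definition edited :: "('s \<times> 'q) set \<Rightarrow> ('s \<times> 'q) set \<Rightarrow> ('s \<times> 'q) set" where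
  "edited E F = (E - F) \<union> (F - E)"

definition feasible_edits ::
    "'s set \<Rightarrow> 'q set \<Rightarrow> ('s \<times> 'q) set \<Rightarrow> ('s \<Rightarrow> nat) \<Rightarrow> ('q \<Rightarrow> nat) \<Rightarrow> nat
      \<Rightarrow> ('s \<times> 'q) set \<Rightarrow> bool" where
  "feasible_edits S Q E \<alpha> \<beta> k F \<longleftrightarrow>
     F \<subseteq> S \<times> Q \<and>
     (\<exists>\<pi>. is_ordering S \<pi> \<and> nested S (edited E F) \<pi> \<and> near S k \<alpha> \<pi>) \<and>
     interval_property S Q (edited E F) \<beta>"

definition near_chain_instance ::
    "'s set \<Rightarrow> 'q set \<Rightarrow> ('s \<times> 'q) set \<Rightarrow> ('s \<Rightarrow> nat) \<Rightarrow> ('q \<Rightarrow> nat) \<Rightarrow> nat \<Rightarrow> bool" where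
  "near_chain_instance S Q E \<alpha> \<beta> k \<longleftrightarrow>
     finite S \<and> finite Q \<and> E \<subseteq> S \<times> Q \<and> is_ordering S \<alpha> \<and> is_ordering Q \<beta> \<and> k > 0"

definition near_chain_solution ::
    "'s set \<Rightarrow> 'q set \<Rightarrow> ('s \<times> 'q) set \<Rightarrow> ('s \<Rightarrow> nat) \<Rightarrow> ('q \<Rightarrow> nat) \<Rightarrow> nat
      \<Rightarrow> ('s \<times> 'q) set \<Rightarrow> bool" where
  "near_chain_solution S Q E \<alpha> \<beta> k F \<longleftrightarrow> is_arg_min card (feasible_edits S Q E \<alpha> \<beta> k) F"


section \<open>The machine model\<close>

text \<open>
  A random access machine with an unbounded memory of natural numbers, a read-only input
  tape and a write-only output tape, under the uniform cost criterion: every instruction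
  and every evaluation of a test takes one step. The only arithmetic is addition
  and truncated subtraction; unit-cost multiplication is deliberately left out, since it
  would make the uniform cost criterion unrealistic. Control flow is structured.
\<close>

type_synonym memory = "nat \<Rightarrow> nat"

datatype operand = Const nat | Cell nat | Indirect nat

fun val :: "memory \<Rightarrow> operand \<Rightarrow> nat" where
  "val M (Const c) = c"
| "val M (Cell i) = M i"
| "val M (Indirect i) = M (M i)"

datatype target = To_Cell nat | To_Indirect nat

fun address :: "memory \<Rightarrow> target \<Rightarrow> nat" where
  "address M (To_Cell i) = i"
| "address M (To_Indirect i) = M i"

datatype test = Less operand operand | Leq operand operand | Equal operand operand

fun holds :: "memory \<Rightarrow> test \<Rightarrow> bool" where
  "holds M (Less a b) \<longleftrightarrow> val M a < val M b"
| "holds M (Leq a b) \<longleftrightarrow> val M a \<le> val M b"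
| "holds M (Equal a b) \<longleftrightarrow> val M a = val M b"

datatype program =
    Skip
  | Move target operand
  | Add target operand operand
  | Sub target operand operand
  | Read target
  | Write operand
  | Seq program program
  | If test program program
  | While test program

text \<open>Memory, unread part of the input, output written so far.\<close>

type_synonym config = "memory \<times> nat list \<times> nat list"

text \<open>
  \<open>executes P c t c'\<close>: started in \<open>c\<close>, the program \<open>P\<close> halts in \<open>c'\<close> after exactly \<open>t\<close> steps.
  Reading past the end of the input gets stuck.
\<close>

inductive executes :: "program \<Rightarrow> config \<Rightarrow> nat \<Rightarrow> config \<Rightarrow> bool" where
  Skip: "executes Skip c 1 c"
| Move: "executes (Move d a) (M, inp, out) 1 (M(address M d := val M a), inp, out)"
| Add: "executes (Add d a b) (M, inp, out) 1 (M(address M d := val M a + val M b), inp, out)"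
| Sub: "executes (Sub d a b) (M, inp, out) 1 (M(address M d := val M a - val M b), inp, out)"
| Read: "executes (Read d) (M, x # inp, out) 1 (M(address M d := x), inp, out)"
| Write: "executes (Write a) (M, inp, out) 1 (M, inp, out @ [val M a])"
| Seq: "executes P c t c' \<Longrightarrow> executes R c' u c'' \<Longrightarrow> executes (Seq P R) c (t + u) c''"
| If_True: "holds (fst c) b \<Longrightarrow> executes P c t c' \<Longrightarrow> executes (If b P R) c (1 + t) c'"
| If_False: "\<not> holds (fst c) b \<Longrightarrow> executes R c t c' \<Longrightarrow> executes (If b P R) c (1 + t) c'"
| While_False: "\<not> holds (fst c) b \<Longrightarrow> executes (While b P) c 1 c"
| While_True: "holds (fst c) b \<Longrightarrow> executes P c t c' \<Longrightarrow> executes (While b P) c' u c'' \<Longrightarrow>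
    executes (While b P) c (1 + t + u) c''"

lemma executes_deterministic:
  "executes P c t c' \<Longrightarrow> executes P c u d \<Longrightarrow> u = t \<and> d = c'"
proof (induction arbitrary: u d rule: executes.induct)
  case (Skip c)
  from Skip.prems show ?case by cases simp_all
next
  case (Move d a M inp out)
  from Move.prems show ?case by cases simp_all
next
  case (Add d a b M inp out)
  from Add.prems show ?case by cases simp_all
next
  case (Sub d a b M inp out)
  from Sub.prems show ?case by cases simp_all
next
  case (Read d M x inp out)
  from Read.prems show ?case by cases simp_all
next
  case (Write a M inp out)
  from Write.prems show ?case by cases simp_all
next
  case (Seq P c t c' R v c'')
  from Seq.prems obtain t1 t2 e
    where e: "executes P c t1 e" "executes R e t2 d" "u = t1 + t2"
    by cases simp
  with Seq.IH(1)[OF e(1)] Seq.IH(2)[of t2 d] show ?case by simp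
next
  case (If_True c b P t c' R)
  from If_True.prems obtain t1 where e: "executes P c t1 d" "u = 1 + t1"
    by cases (use If_True.hyps(1) in simp_all)
  with If_True.IH[OF e(1)] show ?case by simp
next
  case (If_False c b R t c' P)
  from If_False.prems obtain t1 where e: "executes R c t1 d" "u = 1 + t1"
    by cases (use If_False.hyps(1) in simp_all)
  with If_False.IH[OF e(1)] show ?case by simp
next
  case (While_False c b P)
  from While_False.prems show ?case
    by cases (use While_False.hyps(1) in simp_all)
next
  case (While_True c b P t c' v c'')
  from While_True.prems obtain t1 t2 e
    where e: "executes P c t1 e" "executes (While b P) e t2 d" "u = 1 + t1 + t2"
    by cases (use While_True.hyps(1) in simp_all)
  with While_True.IH(1)[OF e(1)] While_True.IH(2)[of t2 d] show ?case by simp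
qed

text \<open>The memory is initially zero.\<close>

definition runs :: "program \<Rightarrow> nat list \<Rightarrow> nat \<Rightarrow> nat list \<Rightarrow> bool" where
  "runs P inp t out \<longleftrightarrow> (\<exists>M rest. executes P (\<lambda>_. 0, inp, []) t (M, rest, out))"


section \<open>Encoding of inputs and outputs\<close>

text \<open>
  The \<open>m\<close> students and \<open>p\<close> questions are named \<open>0, \<dots>, m - 1\<close> and \<open>0, \<dots>, p - 1\<close>. The input
  consists of \<open>m\<close>, \<open>p\<close>, \<open>k\<close>, the two orderings, and the adjacency matrix row by row.
\<close>

definition encode_input ::
    "nat \<Rightarrow> nat \<Rightarrow> (nat \<times> nat) set \<Rightarrow> (nat \<Rightarrow> nat) \<Rightarrow> (nat \<Rightarrow> nat) \<Rightarrow> nat \<Rightarrow> nat list" where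
  "encode_input m p E \<alpha> \<beta> k =
     [m, p, k] @ map \<alpha> [0..<m] @ map \<beta> [0..<p] @
     concat (map (\<lambda>s. map (\<lambda>q. of_bool ((s, q) \<in> E)) [0..<p]) [0..<m])"

text \<open>A set of pairs is output as a list of its elements, in any order but without repetition.\<close>

definition encodes_output :: "nat list \<Rightarrow> (nat \<times> nat) set \<Rightarrow> bool" where
  "encodes_output out F \<longleftrightarrow>
     (\<exists>fs. distinct fs \<and> set fs = F \<and> out = concat (map (\<lambda>(s, q). [s, q]) fs))"

end

theory Submission
  imports Defs
begin

text \<open>
  Let student \<open>s\<close> own the slot \<open>\<alpha> s + k - 1\<close>, and regard the slots below \<open>k\<close> as taken from the
  start. Then \<open>\<pi>\<close> is admissible iff for each \<open>i\<close> the student at position \<open>i + 1\<close> owns one of the slots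
  \<open>i, \<dots>, i + 2 k\<close>. If the positions are filled from left to right, all slots below \<open>i\<close> have
  to be taken once \<open>i\<close> positions are filled, and no slot from \<open>i + 2 k\<close> on can be taken; so the set of
  taken slots is a mask of \<open>2 k\<close> bits. The interval property reduces the neighbourhood of a
  student to a level in \<open>{0..p}\<close>, and nestedness says that the levels do not decrease along \<open>\<pi>\<close>. A dynamic
  program over triples (number of filled positions, level, mask), whose moves raise the level
  or fill the next position, therefore finds an optimal solution. It has \<open>O(m p 4\<^sup>k)\<close> nodes with
  \<open>O(k)\<close> moves each. As \<open>16\<^sup>k = O(k\<^sup>2\<^sup>k)\<close>, a move may take time \<open>O(p + 4\<^sup>k)\<close>, which makes it affordable
  to halve masks by repeated subtraction and to recount the edits of a student every time.
\<close>

section \<open>A weakest precondition calculus with a clock\<close>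

text \<open>The stored values are costs-to-go: \<open>opt i j x\<close> prices the cheapest way to
  finish from a node. An optimal schedule can therefore be read off forwards from the initial node,
  and its edits are written as soon as a position is fixed, with nothing to reverse. Making the
  level part of the node and raising it by separate moves keeps O(k) moves per node; choosing a
  student and a level together would cost another factor \<open>p\<close>. The artificial slots
  below \<open>k\<close> make both ends alike: students own the slots
  \<open>k, ..., m + k - 1\<close>, so the mask is 2^k - 1 before the first position is filled and
  again after the last one. The machine has neither multiplication nor bit operations. Masks are
  handled by adding powers of two, parity and halving only, and node indices are maintained
  incrementally. Loop invariants carry an upper bound on the clock, so correctness and running time
  come out of the same inductions.\<close>

lemma executes_iffs:
  "executes Skip c u c' \<longleftrightarrow> u = 1 \<and> c' = c"
  "executes (Move d a) (M, inp, out) u c' \<longleftrightarrow> u = 1 \<and> c' = (M(address M d := val M a), inp, out)"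
  "executes (Add d a b) (M, inp, out) u c' \<longleftrightarrow>
     u = 1 \<and> c' = (M(address M d := val M a + val M b), inp, out)"
  "executes (Sub d a b) (M, inp, out) u c' \<longleftrightarrow>
     u = 1 \<and> c' = (M(address M d := val M a - val M b), inp, out)"
  "executes (Read d) (M, x # inp, out) u c' \<longleftrightarrow> u = 1 \<and> c' = (M(address M d := x), inp, out)"
  "executes (Write a) (M, inp, out) u c' \<longleftrightarrow> u = 1 \<and> c' = (M, inp, out @ [val M a])"
  "executes (Seq P R) c u c' \<longleftrightarrow>
     (\<exists>v w c''. u = v + w \<and> executes P c v c'' \<and> executes R c'' w c')"
  "executes (If e P R) c u c' \<longleftrightarrow>
     (\<exists>v. u = 1 + v \<and> (if holds (fst c) e then executes P c v c' else executes R c v c'))"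
  by (subst executes.simps; force)+

type_synonym assertion = "memory \<Rightarrow> nat list \<Rightarrow> nat list \<Rightarrow> nat \<Rightarrow> bool"

text \<open>A weakest precondition in which the last argument of an assertion is a clock:
  it counts the steps executed so far.\<close>

definition wp :: "program \<Rightarrow> assertion \<Rightarrow> assertion" where
  "wp P Q M inp out t \<longleftrightarrow>
     (\<exists>u M' inp' out'. executes P (M, inp, out) u (M', inp', out') \<and> Q M' inp' out' (t + u))"

lemma wp_Skip: "wp Skip Q M inp out t = Q M inp out (t + 1)"
  by (simp add: wp_def executes_iffs)

lemma wp_Move: "wp (Move d a) Q M inp out t = Q (M(address M d := val M a)) inp out (t + 1)"
  by (simp add: wp_def executes_iffs)

lemma wp_Add:
  "wp (Add d a b) Q M inp out t = Q (M(address M d := val M a + val M b)) inp out (t + 1)"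
  by (simp add: wp_def executes_iffs)

lemma wp_Sub:
  "wp (Sub d a b) Q M inp out t = Q (M(address M d := val M a - val M b)) inp out (t + 1)"
  by (simp add: wp_def executes_iffs)

lemma wp_Read: "wp (Read d) Q M (x # inp) out t = Q (M(address M d := x)) inp out (t + 1)"
  by (simp add: wp_def executes_iffs)

lemma wp_Write: "wp (Write a) Q M inp out t = Q M inp (out @ [val M a]) (t + 1)"
  by (simp add: wp_def executes_iffs)

lemma wp_Seq: "wp (Seq P R) Q M inp out t = wp P (wp R Q) M inp out t"
proof
  assume "wp (Seq P R) Q M inp out t"
  then obtain v w M1 i1 o1 M2 i2 o2 where
    "executes P (M, inp, out) v (M1, i1, o1)" "executes R (M1, i1, o1) w (M2, i2, o2)"
    "Q M2 i2 o2 (t + v + w)"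
    by (auto simp: wp_def executes_iffs add.assoc)
  then show "wp P (wp R Q) M inp out t" unfolding wp_def by blast
next
  assume "wp P (wp R Q) M inp out t"
  then obtain v w M1 i1 o1 M2 i2 o2 where
    "executes P (M, inp, out) v (M1, i1, o1)" "executes R (M1, i1, o1) w (M2, i2, o2)"
    "Q M2 i2 o2 (t + (v + w))"
    by (auto simp: wp_def add.assoc)
  then show "wp (Seq P R) Q M inp out t" unfolding wp_def by (blast intro: executes.Seq)
qed

lemma wp_If:
  "wp (If b P R) Q M inp out t =
     (if holds M b then wp P Q M inp out (t + 1) else wp R Q M inp out (t + 1))"
proof
  assume "wp (If b P R) Q M inp out t"
  then obtain v M' inp' out' where
    "if holds M b then executes P (M, inp, out) v (M', inp', out')
     else executes R (M, inp, out) v (M', inp', out')" "Q M' inp' out' (t + (1 + v))"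
    by (auto simp: wp_def executes_iffs)
  then show "if holds M b then wp P Q M inp out (t + 1) else wp R Q M inp out (t + 1)"
    unfolding wp_def add.assoc by (cases "holds M b"; simp only: if_True if_False; blast)
next
  assume "if holds M b then wp P Q M inp out (t + 1) else wp R Q M inp out (t + 1)"
  then obtain v M' inp' out' where
    "if holds M b then executes P (M, inp, out) v (M', inp', out')
     else executes R (M, inp, out) v (M', inp', out')" "Q M' inp' out' (t + (1 + v))"
    unfolding wp_def add.assoc by (auto split: if_splits)
  then show "wp (If b P R) Q M inp out t"
    unfolding wp_def executes_iffs fst_conv by blast
qed

lemma wp_While_False:
  "\<not> holds M b \<Longrightarrow> Q M inp out (t + 1) \<Longrightarrow> wp (While b P) Q M inp out t"
  unfolding wp_def by (metis executes.While_False fst_conv)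

lemma wp_While_True:
  assumes "holds M b" "wp P (wp (While b P) Q) M inp out (t + 1)"
  shows "wp (While b P) Q M inp out t"
proof -
  from assms(2) obtain u v M1 i1 o1 M2 i2 o2 where
    e: "executes P (M, inp, out) u (M1, i1, o1)" "executes (While b P) (M1, i1, o1) v (M2, i2, o2)"
    and Q: "Q M2 i2 o2 (t + (1 + u + v))" by (auto simp: wp_def add.assoc)
  have "executes (While b P) (M, inp, out) (1 + u + v) (M2, i2, o2)"
    by (rule executes.While_True[OF _ e]) (use assms(1) in simp)
  with Q show ?thesis unfolding wp_def by blast
qed

lemma wp_mono:
  "wp P Q M inp out t \<Longrightarrow> (\<And>M' inp' out' t'. Q M' inp' out' t' \<Longrightarrow> Q' M' inp' out' t') \<Longrightarrow>
    wp P Q' M inp out t"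
  unfolding wp_def by blast

text \<open>The number \<open>n\<close> of rounds is known in advance for every loop used here, so
  the invariant is indexed by the rounds completed and no termination measure is needed. Clock
  bounds linear in \<open>i\<close> become part of the invariant.\<close>

lemma wp_loop:
  fixes I :: "nat \<Rightarrow> assertion"
  assumes init: "I 0 M inp out t"
    and step: "\<And>i M inp out t. i < n \<Longrightarrow> I i M inp out t \<Longrightarrow>
      holds M b \<and> wp P (I (Suc i)) M inp out (t + 1)"
    and exit: "\<And>M inp out t. I n M inp out t \<Longrightarrow> \<not> holds M b \<and> Q M inp out (t + 1)"
  shows "wp (While b P) Q M inp out t"
proof -
  have "wp (While b P) Q M inp out t" if "i \<le> n" "I i M inp out t" for i M inp out t
    using that
  proof (induction "n - i" arbitrary: i M inp out t)
    case 0
    then show ?case using exit by (intro wp_While_False) auto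
  next
    case (Suc d)
    then have "i < n" by simp
    then have IH: "wp (While b P) Q M' inp' out' t'" if "I (Suc i) M' inp' out' t'" for M' inp' out' t'
      using Suc.hyps(1)[of "Suc i"] Suc.hyps(2) that by simp
    note * = step[OF \<open>i < n\<close> Suc.prems(2)]
    show ?case
      by (rule wp_While_True[OF conjunct1[OF *] wp_mono[OF conjunct2[OF *] IH]])
  qed
  from this[of 0] init show ?thesis by simp
qed

section \<open>Arrays in memory and computed addresses\<close>

fun block :: "program list \<Rightarrow> program" where
  "block [] = Skip"
| "block [P] = P"
| "block (P # Ps) = Seq P (block Ps)"

text \<open>The memory is split into registers, the cells below 32, and eight unbounded arrays
  that are interleaved in the remaining cells, so that no array needs to know the size of
  another one. Cell 0 is reserved for computed addresses.\<close>

definition arr :: "nat \<Rightarrow> memory \<Rightarrow> nat \<Rightarrow> nat" where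
  "arr a M e = M (32 + 8 * e + a)"

definition upd :: "nat \<Rightarrow> nat \<Rightarrow> nat \<Rightarrow> memory \<Rightarrow> memory" where
  "upd a e v M = M(32 + 8 * e + a := v)"

text \<open>Three doublings replace the multiplication by 8.\<close>

definition locate :: "nat \<Rightarrow> nat \<Rightarrow> program" where
  "locate a e = block
     [Add (To_Cell 0) (Cell e) (Cell e),
      Add (To_Cell 0) (Cell 0) (Cell 0),
      Add (To_Cell 0) (Cell 0) (Cell 0),
      Add (To_Cell 0) (Cell 0) (Const (32 + a))]"

definition load :: "nat \<Rightarrow> nat \<Rightarrow> nat \<Rightarrow> program" where
  "load r a e = Seq (locate a e) (Move (To_Cell r) (Indirect 0))"

definition store :: "nat \<Rightarrow> nat \<Rightarrow> nat \<Rightarrow> program" where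
  "store a e r = Seq (locate a e) (Move (To_Indirect 0) (Cell r))"

lemma arr_reg [simp]: "r < 32 \<Longrightarrow> arr a (M(r := v)) = arr a M"
  by (auto simp: arr_def fun_eq_iff)

lemma upd_reg [simp]: "r < 32 \<Longrightarrow> upd a e v M r = M r"
  by (auto simp: upd_def)

text \<open>Addresses in different arrays differ modulo 8; within one array they differ in the
  quotient.\<close>

lemma arr_upd [simp]:
  assumes "a < 8" "a' < 8"
  shows "arr a (upd a' e v M) = (if a = a' then (arr a M)(e := v) else arr a M)"
proof -
  have "a = a' \<and> e' = e" if "32 + 8 * e' + a = 32 + 8 * e + a'" for e'
  proof -
    have "(8 * e' + a) mod 8 = (8 * e + a') mod 8" using that by simp
    then show ?thesis using assms that by simp
  qed
  then show ?thesis by (auto simp: arr_def upd_def fun_eq_iff)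
qed

lemma wp_load:
  "e \<noteq> 0 \<Longrightarrow> wp (load r a e) Q M inp out t =
    Q (M(0 := 32 + 8 * M e + a, r := arr a M (M e))) inp out (t + 5)"
  by (simp add: load_def locate_def wp_Seq wp_Add wp_Move arr_def ac_simps eval_nat_numeral)

lemma wp_store:
  "e \<noteq> 0 \<Longrightarrow> r \<noteq> 0 \<Longrightarrow> wp (store a e r) Q M inp out t =
    Q (upd a (M e) (M r) (M(0 := 32 + 8 * M e + a))) inp out (t + 5)"
  by (simp add: store_def locate_def wp_Seq wp_Add wp_Move upd_def ac_simps eval_nat_numeral)

lemmas wp_simps = wp_Skip wp_Move wp_Add wp_Sub wp_Read wp_Write wp_Seq wp_If wp_load wp_store

section \<open>The dynamic program\<close>

text \<open>The parity test asks whether slot \<open>i\<close> is taken once slot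
  \<open>i + b\<close> is added: the next position reaches only slots from \<open>i + 1\<close> on,
  so a gap at \<open>i\<close> could never be closed.\<close>

definition free_slot :: "nat \<Rightarrow> nat \<Rightarrow> bool" where
  "free_slot x b \<longleftrightarrow> \<not> bit x b \<and> odd (x + 2 ^ b)"

text \<open>Halving discards slot \<open>i\<close>, which the parity test has found taken, and
  rebases the mask at \<open>i + 1\<close>.\<close>

definition occupy :: "nat \<Rightarrow> nat \<Rightarrow> nat" where
  "occupy x b = (x + 2 ^ b) div 2"

definition used :: "nat \<Rightarrow> nat \<Rightarrow> nat set" where
  "used i x = {i + b |b. bit x b}"

text \<open>Adding a power of two whose bit is clear produces no carry, so the sum is a bitwise
  or.\<close>

lemma bit_add_power:
  fixes x :: nat
  assumes "\<not> bit x b"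
  shows "bit (x + 2 ^ b) c \<longleftrightarrow> bit x c \<or> c = b"
proof -
  have "x + 2 ^ b = or x (2 ^ b)"
    by (rule disjunctive_add_eq_or, rule bit_eqI) (use assms in \<open>auto simp: bit_and_iff bit_exp_iff\<close>)
  then show ?thesis
    by (auto simp: bit_or_iff bit_exp_iff)
qed

text \<open>In absolute slots the shift of the mask disappears and only the removal of
  \<open>i\<close> remains.\<close>

lemma used_occupy:
  assumes "\<not> bit x b"
  shows "used (Suc i) (occupy x b) = insert (i + b) (used i x) - {i}"
proof -
  have *: "bit (occupy x b) c \<longleftrightarrow> bit x (Suc c) \<or> Suc c = b" for c
    using bit_add_power[OF assms, of "Suc c"] by (simp add: occupy_def bit_Suc)
  have "t \<in> used (Suc i) (occupy x b) \<longleftrightarrow> t \<in> insert (i + b) (used i x) - {i}" for t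
  proof (cases "i < t")
    case True
    then obtain c where "t = Suc i + c" using less_imp_Suc_add by auto
    then show ?thesis by (auto simp: used_def *)
  next
    case False
    then show ?thesis by (auto simp: used_def)
  qed
  then show ?thesis by blast
qed

lemma odd_add_power_iff:
  assumes "\<not> bit x b"
  shows "odd (x + 2 ^ b) \<longleftrightarrow> i \<in> insert (i + b) (used i x)"
  using bit_add_power[OF assms, of 0] by (auto simp: used_def bit_0)

text \<open>Serves both ends: \<open>i = 0\<close> describes the artificial slots of the initial
  mask, \<open>i = m\<close> the final test in \<open>completes\<close>.\<close>

lemma used_mask: "used i x = {i..<i + k} \<longleftrightarrow> x = 2 ^ k - 1"
proof
  assume eq: "used i x = {i..<i + k}"
  have "bit x b \<longleftrightarrow> b < k" for b
  proof -
    have "bit x b \<longleftrightarrow> i + b \<in> used i x" by (auto simp: used_def)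
    then show ?thesis by (simp add: eq)
  qed
  then have "x = mask k"
    by (intro bit_eqI) (auto simp: bit_mask_iff)
  then show "x = 2 ^ k - 1" by (simp add: mask_eq_exp_minus_1)
next
  assume "x = 2 ^ k - 1"
  then have "x = mask k" by (simp add: mask_eq_exp_minus_1)
  then have "bit x b \<longleftrightarrow> b < k" for b by (auto simp: bit_mask_iff)
  then have "used i x = {i + b |b. b < k}" by (simp add: used_def)
  also have "\<dots> = {i..<i + k}"
    by (auto simp: le_iff_add)
  finally show "used i x = {i..<i + k}" .
qed

text \<open>Before the halving the sum is below 2 * 4^k, even for the topmost offset 2k. This is why
  a window of 2k + 1 slots needs only 2k bits.\<close>

lemma occupy_less:
  assumes "x < 2 ^ (2 * k)" "b \<le> 2 * k"
  shows "occupy x b < 2 ^ (2 * k)"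
proof -
  have "(2::nat) ^ b \<le> 2 ^ (2 * k)" using assms by (intro power_increasing) auto
  with assms(1) show ?thesis unfolding occupy_def by linarith
qed

locale schedule =
  fixes m p k :: nat and cost :: "nat \<Rightarrow> nat \<Rightarrow> nat"
begin

text \<open>A schedule lists slots with levels. Slots that belong to no student need not be excluded
  explicitly: once one of them is taken, the final mask \<open>2\<^sup>k - 1\<close> is out of reach.\<close>

fun completes :: "nat \<Rightarrow> nat \<Rightarrow> nat \<Rightarrow> (nat \<times> nat) list \<Rightarrow> bool" where
  "completes i j x [] \<longleftrightarrow> i = m \<and> x = 2 ^ k - 1"
| "completes i j x ((t, l) # T) \<longleftrightarrow> j \<le> l \<and> l \<le> p \<and>
     (\<exists>b\<le>2 * k. t = i + b \<and> free_slot x b \<and> completes (Suc i) l (occupy x b) T)"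

text \<open>The stepwise bookkeeping of masks amounts to one condition on sets: the slots of the
  schedule and those already taken partition \<open>{i..<m + k}\<close>. In the induction step slot
  \<open>i\<close> must be covered at once, because every later entry is at least
  \<open>i + 1\<close>.\<close>

lemma completes_iff:
  "completes i j x T \<longleftrightarrow>
     i + length T = m \<and> distinct (map fst T) \<and>
     fst ` set T \<union> used i x = {i..<m + k} \<and> fst ` set T \<inter> used i x = {} \<and>
     (\<forall>r<length T. i + r \<le> fst (T ! r) \<and> fst (T ! r) \<le> i + r + 2 * k) \<and>
     sorted (map snd T) \<and> (\<forall>l\<in>snd ` set T. j \<le> l \<and> l \<le> p)"
proof (induction T arbitrary: i j x)
  case Nil
  then show ?case using used_mask[of m x k] by auto
next
  case (Cons a T)
  obtain t l where a: "a = (t, l)" by (cases a)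
  have ge: "used i x \<subseteq> {i..}" by (auto simp: used_def)
  show ?case (is "_ \<longleftrightarrow> ?R")
  proof
    assume "completes i j x (a # T)"
    then obtain b where b: "b \<le> 2 * k" "t = i + b" "free_slot x b" "j \<le> l" "l \<le> p"
      and T: "completes (Suc i) l (occupy x b) T"
      by (auto simp: a)
    have nb: "\<not> bit x b" and i: "i \<in> insert t (used i x)"
      using b odd_add_power_iff[of x b i] by (auto simp: free_slot_def)
    have tx: "t \<notin> used i x" using nb b by (auto simp: used_def)
    note IH = T[unfolded Cons.IH used_occupy[OF nb]]
    have len: "Suc i + length T = m" using IH by blast
    have un: "fst ` set T \<union> (insert t (used i x) - {i}) = {Suc i..<m + k}"
      and dis: "fst ` set T \<inter> (insert t (used i x) - {i}) = {}" using IH b by auto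
    have tl: "i \<notin> fst ` set T"
    proof
      assume "i \<in> fst ` set T"
      then have "i \<in> {Suc i..<m + k}" using un by blast
      then show False by simp
    qed
    have "fst ` set (a # T) \<union> used i x = {i..<m + k}"
    proof -
      have "fst ` set (a # T) \<union> used i x = insert i (fst ` set T \<union> (insert t (used i x) - {i}))"
        using i by (auto simp: a)
      also have "\<dots> = {i..<m + k}" unfolding un using len by auto
      finally show ?thesis .
    qed
    moreover have "fst ` set (a # T) \<inter> used i x = {}" using dis tx tl by (auto simp: a)
    moreover have "distinct (map fst (a # T))" using IH dis tl by (auto simp: a)
    moreover have "\<forall>r<length (a # T). i + r \<le> fst ((a # T) ! r) \<and> fst ((a # T) ! r) \<le> i + r + 2 * k"
      using IH b by (auto simp: a nth_Cons split: nat.split)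
    moreover have "sorted (map snd (a # T))" "\<forall>l\<in>snd ` set (a # T). j \<le> l \<and> l \<le> p"
      using IH b by (auto simp: a)
    ultimately show ?R using len by simp
  next
    assume R: ?R
    define b where "b = t - i"
    have r0: "i \<le> t" "t \<le> i + 2 * k" using R by (auto simp: a)
    then have b: "t = i + b" "b \<le> 2 * k" by (auto simp: b_def)
    have tx: "t \<notin> used i x" using R by (auto simp: a)
    then have nb: "\<not> bit x b" using b by (auto simp: used_def)
    have un: "insert t (fst ` set T) \<union> used i x = {i..<m + k}" using R by (simp add: a)
    have rs: "\<forall>r<length T. Suc i + r \<le> fst (T ! r) \<and> fst (T ! r) \<le> Suc i + r + 2 * k"
      using R by (auto simp: a nth_Cons split: nat.splits)
    have tl: "i \<notin> fst ` set T"
    proof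
      assume "i \<in> fst ` set T"
      then obtain r where "r < length T" "i = fst (T ! r)" by (auto simp: in_set_conv_nth)
      with rs show False by force
    qed
    have "i \<in> {i..<m + k}" using R by simp
    then have i: "i \<in> insert t (used i x)" using tl unfolding un[symmetric] by blast
    have "fst ` set T \<union> (insert t (used i x) - {i}) = {Suc i..<m + k}"
    proof -
      have "fst ` set T \<union> (insert t (used i x) - {i}) = {i..<m + k} - {i}"
        unfolding un[symmetric] using tl by blast
      also have "\<dots> = {Suc i..<m + k}" by auto
      finally show ?thesis .
    qed
    moreover have "fst ` set T \<inter> (insert t (used i x) - {i}) = {}" using R by (auto simp: a)
    moreover have "Suc i + length T = m" "distinct (map fst T)" "sorted (map snd T)"
      and l: "j \<le> l" "l \<le> p" and "\<forall>l'\<in>snd ` set T. l \<le> l' \<and> l' \<le> p"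
      using R by (auto simp: a)
    ultimately have "completes (Suc i) l (occupy x b) T"
      unfolding Cons.IH used_occupy[OF nb] b(1)[symmetric] using rs by blast
    moreover have "free_slot x b"
      using nb i odd_add_power_iff[OF nb, of i] b(1) by (simp add: free_slot_def)
    ultimately show "completes i j x (a # T)"
      using b l by (auto simp: a)
  qed
qed

section \<open>Optimal cost-to-go and its recursion\<close>

definition total :: "(nat \<times> nat) list \<Rightarrow> nat" where
  "total T = (\<Sum>(t, l)\<leftarrow>T. cost t l)"

text \<open>Optimal values are shifted by one, so that the value 0 stands for infinity.\<close>

definition opt :: "nat \<Rightarrow> nat \<Rightarrow> nat \<Rightarrow> nat" where
  "opt i j x = (if \<exists>T. completes i j x T
     then Suc (LEAST c. \<exists>T. completes i j x T \<and> total T = c) else 0)"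

lemma opt_le: "completes i j x T \<Longrightarrow> opt i j x \<noteq> 0 \<and> opt i j x \<le> Suc (total T)"
  unfolding opt_def by (auto intro!: Least_le)

lemma opt_attained:
  assumes "opt i j x \<noteq> 0"
  shows "\<exists>T. completes i j x T \<and> opt i j x = Suc (total T)"
proof -
  have "\<exists>T. completes i j x T" using assms by (auto simp: opt_def split: if_splits)
  then have "\<exists>T. completes i j x T \<and> total T = (LEAST c. \<exists>T. completes i j x T \<and> total T = c)"
    by (intro LeastI_ex[where P = "\<lambda>c. \<exists>T. completes i j x T \<and> total T = c"]) auto
  then show ?thesis by (auto simp: opt_def)
qed

lemma completes_mono: "completes i j x T \<Longrightarrow> j' \<le> j \<Longrightarrow> completes i j' x T"
  by (cases T) auto

text \<open>Beyond the last position or level at most the empty schedule remains. So the border of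
  the table is zero except for a single 1, which is cost 0 after the shift.\<close>

lemma opt_beyond: 
  assumes "i = Suc m \<or> j = Suc p"
  shows "opt i j x = (if i = m \<and> x = 2 ^ k - 1 then 1 else 0)"
proof -
  have C: "completes i j x T \<longleftrightarrow> T = [] \<and> i = m \<and> x = 2 ^ k - 1" for T
  proof (cases T)
    case (Cons a T')
    then show ?thesis using assms by (cases a) (auto simp: completes_iff)
  qed auto
  then have "opt i j x = 0" if "\<not> (i = m \<and> x = 2 ^ k - 1)" using that by (auto simp: opt_def)
  moreover have "opt i j x = 1" if "i = m \<and> x = 2 ^ k - 1"
    using opt_attained[of i j x] opt_le[of i j x "[]"] that by (auto simp: C total_def)
  ultimately show ?thesis by auto
qed

text \<open>The choice \<open>c\<close> is 0 for raising the level and \<open>b + 1\<close> for filling the next position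
  with slot \<open>i + b\<close>; in the latter case \<open>y\<close> is the new mask.\<close>

definition place :: "nat \<Rightarrow> nat \<Rightarrow> nat \<Rightarrow> nat \<Rightarrow> nat" where
  "place i j x b = (if free_slot x b \<and> opt (Suc i) j (occupy x b) \<noteq> 0
     then opt (Suc i) j (occupy x b) + cost (i + b) j else 0)"

text \<open>Invariant of the minimization over the moves out of a node. It is a relation rather than
  a minimum because the reconstruction needs the recorded move and any minimizer will do;
  \<open>c\<close> and \<open>y\<close> are unconstrained as long as no finite candidate has
  appeared.\<close>

definition best_upto :: "nat \<Rightarrow> nat \<Rightarrow> nat \<Rightarrow> nat \<Rightarrow> nat \<Rightarrow> nat \<Rightarrow> nat \<Rightarrow> bool" where
  "best_upto i j x n v c y \<longleftrightarrow>
     (opt i (Suc j) x \<noteq> 0 \<longrightarrow> v \<noteq> 0 \<and> v \<le> opt i (Suc j) x) \<and>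
     (\<forall>b<n. place i j x b \<noteq> 0 \<longrightarrow> v \<noteq> 0 \<and> v \<le> place i j x b) \<and>
     (v \<noteq> 0 \<longrightarrow> (c = 0 \<and> v = opt i (Suc j) x) \<or>
       (\<exists>b<n. c = Suc b \<and> y = occupy x b \<and> v = place i j x b))"

lemma best_upto_0: "best_upto i j x 0 (opt i (Suc j) x) 0 y"
  by (simp add: best_upto_def)

lemma best_upto_keep:
  assumes "best_upto i j x n v c y" "place i j x n \<noteq> 0 \<longrightarrow> v \<noteq> 0 \<and> v \<le> place i j x n"
  shows "best_upto i j x (Suc n) v c y"
  using assms by (auto simp: best_upto_def less_Suc_eq)

lemma best_upto_replace:
  assumes "best_upto i j x n v c y" "place i j x n \<noteq> 0" "v = 0 \<or> place i j x n < v"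
  shows "best_upto i j x (Suc n) (place i j x n) (Suc n) (occupy x n)"
proof -
  have le: "place i j x n \<le> u" if "v \<noteq> 0 \<and> v \<le> u" for u
    using assms(3) that by auto
  have "place i j x n \<le> opt i (Suc j) x" if "opt i (Suc j) x \<noteq> 0"
    by (rule le) (use assms(1) that in \<open>simp add: best_upto_def\<close>)
  moreover have "place i j x n \<le> place i j x b" if "b < Suc n" "place i j x b \<noteq> 0" for b
  proof (cases "b = n")
    case False
    with that have "b < n" by simp
    show ?thesis
      by (rule le) (use assms(1) that(2) \<open>b < n\<close> in \<open>simp add: best_upto_def\<close>)
  qed simp
  ultimately show ?thesis
    using assms(2) by (simp add: best_upto_def)
qed

text \<open>A schedule that completes the node either completes it from level \<open>Suc j\<close>
  too, which includes the empty schedule, or begins with an entry of level exactly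
  \<open>j\<close>.\<close>

lemma best_upto_le:
  assumes best: "best_upto i j x (2 * k + 1) v c y" and T: "completes i j x T"
  shows "v \<noteq> 0 \<and> v \<le> Suc (total T)"
proof (cases "completes i (Suc j) x T")
  case True
  have "opt i (Suc j) x \<noteq> 0 \<longrightarrow> v \<noteq> 0 \<and> v \<le> opt i (Suc j) x"
    using best by (simp add: best_upto_def)
  with opt_le[OF True] show ?thesis by linarith
next
  case False
  obtain b T' where b: "b < 2 * k + 1" "T = (i + b, j) # T'" "free_slot x b"
    and T': "completes (Suc i) j (occupy x b) T'"
    using T False by (cases T) (auto simp: not_less_eq_eq)
  have "place i j x b = opt (Suc i) j (occupy x b) + cost (i + b) j" "place i j x b \<noteq> 0"
    using opt_le[OF T'] b(3) by (simp_all add: place_def)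
  moreover from this(2) have "v \<noteq> 0 \<and> v \<le> place i j x b"
    using best b(1) by (simp add: best_upto_def)
  ultimately show ?thesis using opt_le[OF T'] by (simp add: b(2) total_def)
qed

lemma best_upto_choice:
  assumes "best_upto i j x n v c y" "v \<noteq> 0"
  obtains "c = 0" "v = opt i (Suc j) x"
  | b where "b < n" "c = Suc b" "y = occupy x b" "free_slot x b" "opt (Suc i) j y \<noteq> 0"
      "v = opt (Suc i) j y + cost (i + b) j"
proof -
  have "(c = 0 \<and> v = opt i (Suc j) x) \<or>
       (\<exists>b<n. c = Suc b \<and> y = occupy x b \<and> v = place i j x b)"
    using assms by (simp add: best_upto_def)
  then show thesis
    using that assms(2) by (auto simp: place_def split: if_splits)
qed

text \<open>Bellman's equation: once all 2k + 1 offsets are examined, being a lower bound and being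
  attained by a recorded move pin down the optimum. An entry of level \<open>j\<close> is legal by
  \<open>j \<le> p\<close>.\<close>

lemma best_upto_opt:
  assumes best: "best_upto i j x (2 * k + 1) v c y" and j: "j \<le> p"
  shows "v = opt i j x"
proof (cases "v = 0")
  case True
  then have "\<not> completes i j x T" for T using best_upto_le[OF best] by blast
  then show ?thesis using True by (simp add: opt_def)
next
  case False
  obtain T where T: "completes i j x T" "v = Suc (total T)"
  proof (rule best_upto_choice[OF best False])
    assume v: "v = opt i (Suc j) x"
    with False obtain T where "completes i (Suc j) x T" "v = Suc (total T)"
      using opt_attained[of i "Suc j" x] by metis
    then show thesis using completes_mono[of i "Suc j" x T j] that by simp
  next
    fix b assume b: "b < 2 * k + 1" "y = occupy x b" "free_slot x b" "opt (Suc i) j y \<noteq> 0"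
      "v = opt (Suc i) j y + cost (i + b) j"
    from opt_attained[OF b(4)] obtain T where T: "completes (Suc i) j y T"
      "opt (Suc i) j y = Suc (total T)" by blast
    show thesis
      by (rule that[of "(i + b, j) # T"]) (use b j T in \<open>auto simp: total_def\<close>)
  qed
  obtain T' where T': "completes i j x T'" "opt i j x = Suc (total T')"
    using opt_le[OF T(1)] opt_attained[of i j x] by blast
  show ?thesis
    using opt_le[OF T(1)] best_upto_le[OF best T'(1)] T(2) T'(2) by linarith
qed

end

section \<open>Optimal schedules and optimal edit sets\<close>

text \<open>The parameters are contents of memory: student and row offset of a slot, question order,
  adjacency matrix. They are arbitrary here, so that costs make sense for slots of no student as
  well; such slots do occur in nodes whose mask is unreachable from the start.\<close>

locale tables =
  fixes m p k :: nat and sl rp \<beta> g :: "nat \<Rightarrow> nat"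
begin

definition diffs :: "nat \<Rightarrow> nat \<Rightarrow> nat list" where
  "diffs t l = filter (\<lambda>q. of_bool (\<beta> q \<le> l) \<noteq> g (rp t + q)) [0..<p]"

definition edits :: "(nat \<times> nat) list \<Rightarrow> (nat \<times> nat) list" where
  "edits T = concat (map (\<lambda>(t, l). map (Pair (sl t)) (diffs t l)) T)"

sublocale schedule m p k "\<lambda>t l. length (diffs t l)" .

lemma total_eq_length_edits: "total T = length (edits T)"
  by (induction T) (auto simp: total_def edits_def)

end

locale near_chain = tables m p k sl rp \<beta> g
  for m p k :: nat and sl rp \<beta> g :: "nat \<Rightarrow> nat" +
  fixes E :: "(nat \<times> nat) set" and \<alpha> :: "nat \<Rightarrow> nat"
  assumes inst: "near_chain_instance {..<m} {..<p} E \<alpha> \<beta> k"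
    and sl: "\<And>s. s < m \<Longrightarrow> sl (\<alpha> s + k - 1) = s"
    and rp: "\<And>s. s < m \<Longrightarrow> rp (\<alpha> s + k - 1) = s * p"
    and g: "\<And>s q. s < m \<Longrightarrow> q < p \<Longrightarrow> g (s * p + q) = of_bool ((s, q) \<in> E)"
begin

lemma k_pos: "0 < k" and E_sub: "E \<subseteq> {..<m} \<times> {..<p}"
  and bij_\<alpha>: "bij_betw \<alpha> {..<m} {1..m}" and bij_\<beta>: "bij_betw \<beta> {..<p} {1..p}"
  using inst by (auto simp: near_chain_instance_def is_ordering_def)

lemma \<alpha>_bounds: "s < m \<Longrightarrow> 1 \<le> \<alpha> s \<and> \<alpha> s \<le> m"
  using bij_betw_apply[OF bij_\<alpha>, of s] by simp

definition slot :: "nat \<Rightarrow> nat" where "slot s = \<alpha> s + k - 1"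

lemma sl_slot: "s < m \<Longrightarrow> sl (slot s) = s"
  by (simp only: slot_def sl)

lemma bij_slot: "bij_betw slot {..<m} {k..<m + k}"
proof -
  have "bij_betw (\<lambda>a. a + k - 1) {1..m} {k..<m + k}"
    by (rule bij_betw_byWitness[where f' = "\<lambda>t. t + 1 - k"]) (use k_pos in auto)
  from bij_betw_trans[OF bij_\<alpha> this] show ?thesis
    by (simp add: slot_def comp_def cong: bij_betw_cong)
qed

definition level_edits :: "(nat \<Rightarrow> nat) \<Rightarrow> (nat \<times> nat) set" where
  "level_edits lev = {(s, q). s < m \<and> q < p \<and> (\<beta> q \<le> lev s) \<noteq> ((s, q) \<in> E)}"

lemma set_diffs:
  "s < m \<Longrightarrow> set (diffs (slot s) l) = {q. q < p \<and> (\<beta> q \<le> l) \<noteq> ((s, q) \<in> E)}"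
  using rp[of s] by (auto simp: diffs_def slot_def g)

lemma interval_eq: "l \<le> p \<Longrightarrow> inv_into {..<p} \<beta> ` {1..l} = {q. q < p \<and> \<beta> q \<le> l}"
proof (intro set_eqI iffI)
  fix q assume l: "l \<le> p" and "q \<in> inv_into {..<p} \<beta> ` {1..l}"
  then obtain a where a: "a \<in> {1..l}" "q = inv_into {..<p} \<beta> a" by blast
  then have "a \<in> \<beta> ` {..<p}" using l bij_betw_imp_surj_on[OF bij_\<beta>] by auto
  with a show "q \<in> {q. q < p \<and> \<beta> q \<le> l}"
    using inv_into_into[of a \<beta> "{..<p}"] f_inv_into_f[of a \<beta> "{..<p}"] by auto
next
  fix q assume "q \<in> {q. q < p \<and> \<beta> q \<le> l}"
  then have q: "q < p" "\<beta> q \<in> {1..l}" using bij_betw_apply[OF bij_\<beta>, of q] by auto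
  then have "q = inv_into {..<p} \<beta> (\<beta> q)"
    using inv_into_f_f[OF bij_betw_imp_inj_on[OF bij_\<beta>], of q] by simp
  with q(2) show "q \<in> inv_into {..<p} \<beta> ` {1..l}" by (rule rev_image_eqI)
qed

lemma edited_level_edits: "edited E (level_edits lev) = {(s, q). s < m \<and> q < p \<and> \<beta> q \<le> lev s}"
  using E_sub by (auto simp: edited_def level_edits_def)

text \<open>For \<open>l > 0\<close> the question at position \<open>l\<close> belongs to the prefix
  of length \<open>l\<close>, which forces \<open>l \<le> l'\<close>.\<close>

lemma prefix_subset_iff:
  assumes "l \<le> p" "l' \<le> p"
  shows "{q. q < p \<and> \<beta> q \<le> l} \<subseteq> {q. q < p \<and> \<beta> q \<le> l'} \<longleftrightarrow> l \<le> l'"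
proof
  assume sub: "{q. q < p \<and> \<beta> q \<le> l} \<subseteq> {q. q < p \<and> \<beta> q \<le> l'}"
  show "l \<le> l'"
  proof (cases "l = 0")
    case False
    then have "l \<in> \<beta> ` {..<p}" using assms bij_betw_imp_surj_on[OF bij_\<beta>] by auto
    then show ?thesis using sub by auto
  qed simp
qed auto

text \<open>The levels determine the edit set: the interval property makes neighbourhoods prefixes,
  inclusion of prefixes is the order of levels, and \<open>F\<close> must consist of the pairs on
  which prefixes and \<open>E\<close> disagree.\<close>

lemma feasible_iff:
  "feasible_edits {..<m} {..<p} E \<alpha> \<beta> k F \<longleftrightarrow>
     (\<exists>\<pi> lev. bij_betw \<pi> {..<m} {1..m} \<and> near {..<m} k \<alpha> \<pi> \<and> (\<forall>s<m. lev s \<le> p) \<and>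
       (\<forall>s<m. \<forall>s'<m. \<pi> s' \<le> \<pi> s \<longrightarrow> lev s' \<le> lev s) \<and> F = level_edits lev)"
  (is "?L \<longleftrightarrow> ?R")
proof
  assume L: ?L
  then obtain \<pi> where F: "F \<subseteq> {..<m} \<times> {..<p}" and \<pi>: "bij_betw \<pi> {..<m} {1..m}"
    "near {..<m} k \<alpha> \<pi>" "nested {..<m} (edited E F) \<pi>"
    by (auto simp: feasible_edits_def is_ordering_def)
  have "\<forall>s<m. \<exists>l\<le>p. nbhd (edited E F) s = {q. q < p \<and> \<beta> q \<le> l}"
    using L interval_eq by (force simp: feasible_edits_def interval_property_def)
  then obtain lev where lev: "\<And>s. s < m \<Longrightarrow> lev s \<le> p"
    "\<And>s. s < m \<Longrightarrow> nbhd (edited E F) s = {q. q < p \<and> \<beta> q \<le> lev s}" by metis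
  have "lev s' \<le> lev s" if "s < m" "s' < m" "\<pi> s' \<le> \<pi> s" for s s'
  proof -
    have "nbhd (edited E F) s' \<subseteq> nbhd (edited E F) s"
      using \<pi>(3) that by (auto simp: nested_def)
    then show ?thesis using lev that by (simp add: prefix_subset_iff)
  qed
  moreover have "F = level_edits lev"
  proof -
    have "(s, q) \<in> edited E F \<longleftrightarrow> q < p \<and> \<beta> q \<le> lev s" if "s < m" for s q
      using lev(2)[OF that] by (auto simp: nbhd_def)
    then have "(s, q) \<in> F \<longleftrightarrow> (s, q) \<in> level_edits lev" for s q
      using F E_sub by (auto simp: level_edits_def edited_def)
    then show ?thesis by auto
  qed
  ultimately show ?R using \<pi> lev by blast
next
  assume ?R
  then obtain \<pi> lev where \<pi>: "bij_betw \<pi> {..<m} {1..m}" "near {..<m} k \<alpha> \<pi>"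
    and lev: "\<And>s. s < m \<Longrightarrow> lev s \<le> p" "\<And>s s'. s < m \<Longrightarrow> s' < m \<Longrightarrow> \<pi> s' \<le> \<pi> s \<Longrightarrow> lev s' \<le> lev s"
    and F: "F = level_edits lev" by blast
  have nb: "nbhd (edited E F) s = {q. q < p \<and> \<beta> q \<le> lev s}" if "s < m" for s
    using that by (auto simp: F edited_level_edits nbhd_def)
  have "interval_property {..<m} {..<p} (edited E F) \<beta>"
    unfolding interval_property_def using nb interval_eq lev(1)
    by (metis atLeastAtMost_iff card_lessThan lessThan_iff zero_le)
  moreover have "nested {..<m} (edited E F) \<pi>"
    using lev by (auto simp: nested_def nb intro: order.trans)
  moreover have "F \<subseteq> {..<m} \<times> {..<p}" by (auto simp: F level_edits_def)
  ultimately show ?L using \<pi> by (auto simp: feasible_edits_def is_ordering_def)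
qed

text \<open>The artificial slots \<open>{0..<k}\<close> cancel on both sides, which leaves exactly
  the slots owned by students.\<close>

lemma completes_start_iff:
  "completes 0 0 (2 ^ k - 1) T \<longleftrightarrow>
     length T = m \<and> distinct (map fst T) \<and> fst ` set T = {k..<m + k} \<and>
     (\<forall>r<length T. r \<le> fst (T ! r) \<and> fst (T ! r) \<le> r + 2 * k) \<and>
     sorted (map snd T) \<and> (\<forall>l\<in>snd ` set T. l \<le> p)"
proof -
  have U: "used 0 (2 ^ k - 1) = {0..<k}" using used_mask[of 0 "2 ^ k - 1" k] by simp
  have AB: "A = {k..<m + k} \<longleftrightarrow> A \<union> {0..<k} = {0..<m + k} \<and> A \<inter> {0..<k} = {}" for A :: "nat set"
  proof
    assume "A \<union> {0..<k} = {0..<m + k} \<and> A \<inter> {0..<k} = {}"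
    then have "A = {0..<m + k} - {0..<k}" by blast
    also have "\<dots> = {k..<m + k}" by auto
    finally show "A = {k..<m + k}" .
  qed auto
  show ?thesis unfolding completes_iff U AB by (simp add: conj_ac)
qed

lemma near_iff: "near {..<m} k \<alpha> \<pi> \<longleftrightarrow> (\<forall>s<m. \<pi> s \<le> \<alpha> s + k \<and> \<alpha> s \<le> \<pi> s + k)"
proof -
  have "int (\<pi> s) \<in> {int (\<alpha> s) - int k..int (\<alpha> s) + int k} \<longleftrightarrow>
      \<pi> s \<le> \<alpha> s + k \<and> \<alpha> s \<le> \<pi> s + k" for s
    by auto
  then show ?thesis by (simp add: near_def Ball_def)
qed

text \<open>A student's position is the place of the student's slot in \<open>T\<close>, counted
  from one. As an injection of \<open>{..<m}\<close> into itself, \<open>pos\<close> is onto, so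
  this is an ordering.\<close>

lemma completes_imp_feasible:
  assumes T: "completes 0 0 (2 ^ k - 1) T"
  shows "feasible_edits {..<m} {..<p} E \<alpha> \<beta> k (set (edits T))" "distinct (edits T)"
proof -
  note C = T[unfolded completes_start_iff]
  have len: "length T = m" using C by blast
  have "\<exists>r<m. fst (T ! r) = slot s" if "s < m" for s
  proof -
    have "slot s \<in> fst ` set T" using bij_betw_apply[OF bij_slot, of s] that C by simp
    then show ?thesis using len by (metis imageE in_set_conv_nth)
  qed
  then obtain pos where pos: "\<And>s. s < m \<Longrightarrow> pos s < m \<and> fst (T ! pos s) = slot s" by metis
  define \<pi> where "\<pi> s = Suc (pos s)" for s
  define lev where "lev s = snd (T ! pos s)" for s
  have inj: "inj_on pos {..<m}"
  proof (rule inj_onI)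
    fix s s' assume "s \<in> {..<m}" "s' \<in> {..<m}" "pos s = pos s'"
    then have "slot s = slot s'" using pos by (metis lessThan_iff)
    with \<open>s \<in> _\<close> \<open>s' \<in> _\<close> show "s = s'" using bij_betw_imp_inj_on[OF bij_slot] by (auto dest: inj_onD)
  qed
  have img: "pos ` {..<m} = {..<m}"
    using inj pos by (intro endo_inj_surj) auto
  have "bij_betw \<pi> {..<m} {1..m}"
  proof -
    have S: "bij_betw Suc {..<m} {1..m}" by (rule bij_betw_byWitness[where f' = "\<lambda>t. t - 1"]) auto
    have "bij_betw pos {..<m} {..<m}" using inj img by (simp add: bij_betw_def)
    from bij_betw_trans[OF this S] show ?thesis by (simp add: \<pi>_def comp_def cong: bij_betw_cong)
  qed
  moreover have "near {..<m} k \<alpha> \<pi>"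
    unfolding near_iff
  proof (intro allI impI)
    fix s assume s: "s < m"
    \<comment> \<open>With \<open>slot s = \<alpha> s + k - 1\<close> and
      \<open>\<pi> s = Suc (pos s)\<close>, the window of 2k + 1 slots is the interval of radius
      \<open>k\<close> around \<open>\<alpha> s\<close>.\<close>
    then have "pos s \<le> slot s" "slot s \<le> pos s + 2 * k" using C pos[OF s] by metis+
    then show "\<pi> s \<le> \<alpha> s + k \<and> \<alpha> s \<le> \<pi> s + k"
      using \<alpha>_bounds[OF s] k_pos by (auto simp: slot_def \<pi>_def)
  qed
  moreover have "\<forall>s<m. lev s \<le> p"
    using C pos len by (auto simp: lev_def)
  moreover have "lev s' \<le> lev s" if "s < m" "s' < m" "\<pi> s' \<le> \<pi> s" for s s'
    using C pos len that sorted_nth_mono[of "map snd T" "pos s'" "pos s"] by (auto simp: lev_def \<pi>_def)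
  moreover have "set (edits T) = level_edits lev"
  proof -
    have "set T = (\<lambda>s. (slot s, lev s)) ` {..<m}"
    proof -
      have "set T = (\<lambda>r. T ! r) ` {..<m}"
        unfolding len[symmetric] set_conv_nth by blast
      also have "\<dots> = (\<lambda>s. T ! pos s) ` {..<m}" by (subst img[symmetric]) (simp add: image_image)
      also have "\<dots> = (\<lambda>s. (slot s, lev s)) ` {..<m}"
        using pos by (intro image_cong) (auto simp: lev_def prod_eq_iff)
      finally show ?thesis .
    qed
    then have "set (edits T) = (\<Union>s\<in>{..<m}. Pair (sl (slot s)) ` set (diffs (slot s) (lev s)))"
      by (simp add: edits_def)
    also have "\<dots> = (\<Union>s\<in>{..<m}. Pair s ` {q. q < p \<and> (\<beta> q \<le> lev s) \<noteq> ((s, q) \<in> E)})"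
      by (intro SUP_cong refl) (simp add: sl_slot set_diffs)
    also have "\<dots> = level_edits lev"
      by (auto simp: level_edits_def)
    finally show ?thesis .
  qed
  ultimately show "feasible_edits {..<m} {..<p} E \<alpha> \<beta> k (set (edits T))"
    unfolding feasible_iff by blast
  \<comment> \<open>Different entries contribute pairs with different students, because
    \<open>sl\<close> is injective on the slots owned by students.\<close>
  have "distinct (edits T')" if "distinct (map fst T')" "fst ` set T' \<subseteq> {k..<m + k}" for T'
    using that
  proof (induction T')
    case (Cons a T')
    obtain t l where a: "a = (t, l)" by (cases a)
    have inj: "inj_on sl {k..<m + k}"
    proof (rule inj_onI)
      fix t t' assume "t \<in> {k..<m + k}" "t' \<in> {k..<m + k}" "sl t = sl t'"
      moreover from this obtain s s' where "s < m" "t = slot s" "s' < m" "t' = slot s'"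
        unfolding bij_betw_imp_surj_on[OF bij_slot, symmetric] by blast
      ultimately show "t = t'" by (simp add: sl_slot)
    qed
    have "sl t \<noteq> sl t'" if t': "t' \<in> fst ` set T'" for t'
    proof
      assume "sl t = sl t'"
      moreover have "t \<in> {k..<m + k}" "t' \<in> {k..<m + k}" "t \<notin> fst ` set T'"
        using t' Cons.prems by (auto simp: a)
      ultimately show False using inj_onD[OF inj, of t t'] t' by blast
    qed
    then have "sl t \<noteq> sl t'" if "(t', l') \<in> set T'" for t' l'
      using image_eqI[OF _ that, of t' fst] by simp
    then have "(sl t, q) \<notin> set (edits T')" for q
      by (auto simp: edits_def)
    then have "set (map (Pair (sl t)) (diffs t l)) \<inter> set (edits T') = {}"
      by auto
    moreover have "edits (a # T') = map (Pair (sl t)) (diffs t l) @ edits T'"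
      by (simp add: a edits_def)
    moreover have "distinct (map (Pair (sl t)) (diffs t l))"
      by (simp add: diffs_def distinct_map inj_on_def)
    moreover have "distinct (edits T')" using Cons by (simp add: a)
    ultimately show ?case by simp
  qed (simp add: edits_def)
  then show "distinct (edits T)" using C by simp
qed

text \<open>The schedule lists the students in the order of \<open>\<pi>\<close> with their levels.
  The costs add up to \<open>card F\<close> because edits of different students are
  disjoint.\<close>

lemma feasible_imp_completes:
  assumes "feasible_edits {..<m} {..<p} E \<alpha> \<beta> k F"
  shows "\<exists>T. completes 0 0 (2 ^ k - 1) T \<and> total T = card F"
proof -
  from assms[unfolded feasible_iff] obtain \<pi> lev where \<pi>: "bij_betw \<pi> {..<m} {1..m}"
    "near {..<m} k \<alpha> \<pi>"
    and lev: "\<And>s. s < m \<Longrightarrow> lev s \<le> p" "\<And>s s'. s < m \<Longrightarrow> s' < m \<Longrightarrow> \<pi> s' \<le> \<pi> s \<Longrightarrow> lev s' \<le> lev s"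
    and F: "F = level_edits lev" by blast
  define st where "st r = inv_into {..<m} \<pi> (Suc r)" for r
  have st: "st r < m" "\<pi> (st r) = Suc r" if "r < m" for r
  proof -
    have "Suc r \<in> \<pi> ` {..<m}" using \<pi>(1) that by (auto simp: bij_betw_def)
    from inv_into_into[OF this] f_inv_into_f[OF this] show "st r < m" "\<pi> (st r) = Suc r"
      by (auto simp: st_def)
  qed
  have inj: "inj_on st {..<m}" by (rule inj_onI) (metis st(2) lessThan_iff nat.inject)
  have img: "st ` {..<m} = {..<m}" using inj st by (intro endo_inj_surj) auto
  define T where "T = map (\<lambda>r. (slot (st r), lev (st r))) [0..<m]"
  have "completes 0 0 (2 ^ k - 1) T"
    unfolding completes_start_iff
  proof (intro conjI allI impI)
    show "length T = m" by (simp add: T_def)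
    have "inj_on (\<lambda>r. slot (st r)) {0..<m}"
      using comp_inj_on[OF inj, of slot] bij_betw_imp_inj_on[OF bij_slot] img
      by (simp add: comp_def lessThan_atLeast0)
    then show "distinct (map fst T)" by (simp add: T_def distinct_map comp_def)
    have "fst ` set T = slot ` st ` {..<m}" by (auto simp: T_def image_image)
    then show "fst ` set T = {k..<m + k}"
      using bij_betw_imp_surj_on[OF bij_slot] by (simp add: img)
    fix r assume "r < length T"
    then have r: "r < m" by (simp add: T_def)
    have "Suc r \<le> \<alpha> (st r) + k" "\<alpha> (st r) \<le> Suc r + k"
      using \<pi>(2) st[OF r] unfolding near_iff by metis+
    then show "r \<le> fst (T ! r)" "fst (T ! r) \<le> r + 2 * k"
      using r k_pos \<alpha>_bounds[OF st(1)[OF r]] by (auto simp: T_def slot_def)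
  next
    show "sorted (map snd T)"
      using st lev(2) by (auto simp: T_def sorted_iff_nth_mono)
    show "\<forall>l\<in>snd ` set T. l \<le> p" using st lev(1) by (auto simp: T_def)
  qed
  moreover have "total T = card F"
  proof -
    have "total T = (\<Sum>r<m. length (diffs (slot (st r)) (lev (st r))))"
      by (simp add: total_def T_def comp_def interv_sum_list_conv_sum_set_nat lessThan_atLeast0)
    also have "\<dots> = (\<Sum>s<m. length (diffs (slot s) (lev s)))"
      using sum.reindex[OF inj, of "\<lambda>s. length (diffs (slot s) (lev s))"] by (simp add: img)
    also have "\<dots> = (\<Sum>s<m. card (set (diffs (slot s) (lev s))))"
      by (intro sum.cong refl distinct_card[symmetric]) (simp add: diffs_def)
    also have "\<dots> = card (SIGMA s:{..<m}. set (diffs (slot s) (lev s)))"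
      by (rule card_SigmaI[symmetric]) auto
    also have "(SIGMA s:{..<m}. set (diffs (slot s) (lev s))) = F"
      by (auto simp: F level_edits_def set_diffs)
    finally show ?thesis .
  qed
  ultimately show ?thesis by blast
qed

text \<open>Deleting all edges is always feasible: take \<open>\<pi> = \<alpha>\<close> and level 0
  for everybody.\<close>

lemma opt_start_nonzero: "opt 0 0 (2 ^ k - 1) \<noteq> 0"
proof -
  have "feasible_edits {..<m} {..<p} E \<alpha> \<beta> k (level_edits (\<lambda>_. 0))"
    unfolding feasible_iff using bij_\<alpha> by (auto simp: near_iff)
  from feasible_imp_completes[OF this] opt_le show ?thesis by blast
qed

lemma optimal_solution:
  assumes T: "completes 0 0 (2 ^ k - 1) T" "opt 0 0 (2 ^ k - 1) = Suc (total T)"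
  shows "near_chain_solution {..<m} {..<p} E \<alpha> \<beta> k (set (edits T))" "distinct (edits T)"
proof -
  have "card (set (edits T)) \<le> card F" if F: "feasible_edits {..<m} {..<p} E \<alpha> \<beta> k F" for F
  proof -
    obtain T' where "completes 0 0 (2 ^ k - 1) T'" "total T' = card F"
      using feasible_imp_completes[OF F] by blast
    with opt_le[of 0 0 "2 ^ k - 1" T'] T(2) completes_imp_feasible(2)[OF T(1)] show ?thesis
      by (simp add: distinct_card total_eq_length_edits)
  qed
  with completes_imp_feasible[OF T(1)]
  show "near_chain_solution {..<m} {..<p} E \<alpha> \<beta> k (set (edits T))" "distinct (edits T)"
    by (auto simp: near_chain_solution_def is_arg_min_def not_less)
qed

end

section \<open>Solving a node\<close>

declare One_nat_def [simp del]

definition frame :: "nat set \<Rightarrow> memory \<Rightarrow> memory \<Rightarrow> bool" where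
  "frame X M M' \<longleftrightarrow> (\<forall>r. r \<notin> X \<longrightarrow> M' r = M r)"

lemma frame_get: "frame X M M' \<Longrightarrow> r \<notin> X \<Longrightarrow> M' r = M r"
  by (simp add: frame_def)

lemma frame_arr: "frame X M M' \<Longrightarrow> X \<subseteq> {..<32} \<Longrightarrow> arr a M' = arr a M"
  by (auto simp: frame_def arr_def fun_eq_iff)

lemma frame_refl [simp]: "frame X M M"
  by (simp add: frame_def)

lemma frame_upd [simp]: "r \<in> X \<Longrightarrow> frame X M (M'(r := v)) \<longleftrightarrow> frame X M M'"
  by (auto simp: frame_def)

text \<open>
  Registers: 2 to 9 hold \<open>m\<close>, \<open>p\<close>, \<open>k\<close>, \<open>W = 4\<^sup>k\<close>, \<open>(p + 2) W\<close>, \<open>2\<^sup>k - 1\<close>, \<open>2 k + 1\<close> and the index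
  of the final node; 10 to 13 hold the current node \<open>i\<close>, \<open>j\<close>, \<open>x\<close> and its index; 14 to 16 hold
  the best value found for it, the choice leading there and the resulting mask; 17 to 19
  hold \<open>x div 2\<^sup>b\<close>, \<open>2\<^sup>b\<close> and \<open>b\<close>; 20 and 21 hold quotient and remainder of a halving;
  25 is the offset of the row of a student in the adjacency matrix.
  Arrays: 0 and 7 map a slot to the student and to the offset of the student's row; 2 is the
  question ordering; 3 is the adjacency matrix; 4 to 6 hold the value, the choice and the
  resulting mask of every node.
\<close>

definition halve :: "nat \<Rightarrow> program" where
  "halve s = block
     [Move (To_Cell 20) (Const 0),
      Move (To_Cell 21) (Cell s),
      While (Leq (Const 2) (Cell 21)) (block
        [Sub (To_Cell 21) (Cell 21) (Const 2),
         Add (To_Cell 20) (Cell 20) (Const 1)])]"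

text \<open>\<open>P\<close> is run at each question where level and matrix disagree. Counting in
  the minimization and writing in the reconstruction share this loop.\<close>

definition scan :: "program \<Rightarrow> program" where
  "scan P = block
     [Move (To_Cell 26) (Const 0),
      While (Less (Cell 26) (Cell 3)) (block
        [Add (To_Cell 23) (Cell 25) (Cell 26),
         load 27 3 23,
         load 28 2 26,
         If (Leq (Cell 28) (Cell 11)) (Move (To_Cell 28) (Const 1)) (Move (To_Cell 28) (Const 0)),
         If (Equal (Cell 28) (Cell 27)) Skip P,
         Add (To_Cell 26) (Cell 26) (Const 1)])]"

definition update_best :: program where
  "update_best = block
     [Move (To_Cell 14) (Cell 24),
      Add (To_Cell 15) (Cell 19) (Const 1),
      Move (To_Cell 16) (Cell 20)]"

text \<open>The index of the successor arises by adding the stride of a position and exchanging the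
  masks; subtracting the old mask last keeps truncated subtraction exact. A successor without
  completion is recognized by its value 0.\<close>

definition relax :: program where
  "relax = block
     [Add (To_Cell 23) (Cell 13) (Cell 6),
      Add (To_Cell 23) (Cell 23) (Cell 20),
      Sub (To_Cell 23) (Cell 23) (Cell 12),
      load 24 4 23,
      If (Less (Const 0) (Cell 24)) (block
        [Add (To_Cell 23) (Cell 10) (Cell 19),
         load 25 7 23,
         scan (Add (To_Cell 24) (Cell 24) (Const 1)),
         If (Less (Const 0) (Cell 14))
           (If (Less (Cell 24) (Cell 14)) update_best Skip)
           update_best])
        Skip]"

definition next_bit :: program where
  "next_bit = block
     [Add (To_Cell 18) (Cell 18) (Cell 18),
      Add (To_Cell 19) (Cell 19) (Const 1)]"

text \<open>Cell 17 is halved once per offset, so the remainder is bit \<open>b\<close>. The second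
  halving does double duty: its remainder decides about slot \<open>i\<close>, its quotient is the
  new mask.\<close>

definition try_place :: program where
  "try_place = block
     [halve 17,
      Move (To_Cell 17) (Cell 20),
      If (Equal (Cell 21) (Const 0)) (block
        [Add (To_Cell 22) (Cell 12) (Cell 18),
         halve 22,
         If (Equal (Cell 21) (Const 1)) relax Skip])
        Skip,
      next_bit]"

definition record_best :: program where
  "record_best = block [store 4 13 14, store 5 13 15, store 6 13 16]"

definition solve_node :: program where
  "solve_node = block
     [Add (To_Cell 23) (Cell 13) (Cell 5),
      load 14 4 23,
      Move (To_Cell 15) (Const 0),
      Move (To_Cell 16) (Const 0),
      Move (To_Cell 17) (Cell 12),
      Move (To_Cell 18) (Const 1),
      Move (To_Cell 19) (Const 0),
      While (Less (Cell 19) (Cell 8)) try_place,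
      record_best]"

text \<open>Three steps per round and \<open>M s div 2\<close> rounds. Time linear in the value is
  affordable, since only numbers below 2 * 4^k are halved.\<close>

lemma wp_halve:
  assumes "s \<notin> {20, 21}"
    and Q: "\<And>t'. t' \<le> t + 3 * M s + 3 \<Longrightarrow>
      Q (M(20 := M s div 2, 21 := M s mod 2)) inp out t'"
  shows "wp (halve s) Q M inp out t"
proof -
  let ?M = "\<lambda>n. M(20 := n, 21 := M s - 2 * n)"
  have "wp (While (Leq (Const 2) (Cell 21)) (block
        [Sub (To_Cell 21) (Cell 21) (Const 2), Add (To_Cell 20) (Cell 20) (Const 1)]))
      Q (?M 0) inp out (t + 1 + 1)"
  proof (rule wp_loop[where n = "M s div 2" and
        I = "\<lambda>n M' inp' out' t'. M' = ?M n \<and> inp' = inp \<and> out' = out \<and> t' \<le> t + 2 + 3 * n"])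
    fix n M' inp' out' t'
    assume n: "n < M s div 2"
      and I: "M' = ?M n \<and> inp' = inp \<and> out' = out \<and> t' \<le> t + 2 + 3 * n"
    have "(?M n)(21 := M s - 2 * n - 2, 20 := Suc n) = ?M (Suc n)"
      by (auto simp: fun_eq_iff)
    then show "holds M' (Leq (Const 2) (Cell 21)) \<and> wp (block
        [Sub (To_Cell 21) (Cell 21) (Const 2), Add (To_Cell 20) (Cell 20) (Const 1)])
      (\<lambda>M' inp' out' t'. M' = ?M (Suc n) \<and> inp' = inp \<and> out' = out \<and> t' \<le> t + 2 + 3 * Suc n)
      M' inp' out' (t' + 1)"
      using n I by (auto simp: wp_simps)
  next
    fix M' inp' out' t'
    assume I: "M' = ?M (M s div 2) \<and> inp' = inp \<and> out' = out \<and> t' \<le> t + 2 + 3 * (M s div 2)"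
    have "M s - 2 * (M s div 2) = M s mod 2" by (simp add: minus_mult_div_eq_mod)
    moreover have "Q (M(20 := M s div 2, 21 := M s mod 2)) inp out (t' + 1)"
      by (rule Q) (use I div_le_dividend[of "M s" 2] in linarith)
    ultimately show "\<not> holds M' (Leq (Const 2) (Cell 21)) \<and> Q M' inp' out' (t' + 1)"
      using I by simp
  qed simp
  then show ?thesis
    using assms(1) by (simp add: halve_def wp_simps)
qed

context tables
begin

text \<open>There is an extra level \<open>p + 1\<close>, on which only the node \<open>(m, p + 1, 2\<^sup>k - 1)\<close> has a finite
  value. As memory is initially 0, which stands for infinity, neither the last level nor
  the last position requires a special case.\<close>

definition idx :: "nat \<Rightarrow> nat \<Rightarrow> nat \<Rightarrow> nat" where
  "idx i j x = (i * (p + 2) + j) * 2 ^ (2 * k) + x"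

definition static :: "memory \<Rightarrow> bool" where
  "static M \<longleftrightarrow> M 2 = m \<and> M 3 = p \<and> M 4 = k \<and> M 5 = 2 ^ (2 * k) \<and> M 6 = (p + 2) * 2 ^ (2 * k) \<and>
     M 7 = 2 ^ k - 1 \<and> M 8 = 2 * k + 1 \<and> M 9 = idx m (Suc p) (2 ^ k - 1) \<and>
     arr 0 M = sl \<and> arr 7 M = rp \<and> (\<forall>q<p. arr 2 M q = \<beta> q) \<and> arr 3 M = g"

lemma static_frame: "static M \<Longrightarrow> frame X M M' \<Longrightarrow> X \<subseteq> insert 0 {10..<32} \<Longrightarrow> static M'"
proof -
  assume S: "static M" and F: "frame X M M'" and X: "X \<subseteq> insert 0 {10..<32}"
  have "r \<notin> X" if "r \<in> {2..9}" for r using X that by auto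
  then have "M' r = M r" if "r \<in> {2..9}" for r using frame_get[OF F] that by blast
  moreover have "arr a M' = arr a M" for a by (rule frame_arr[OF F]) (use X in auto)
  ultimately show ?thesis using S by (simp add: static_def)
qed

lemma scan_step:
  assumes "static M" "frame {0, 23, 24, 26, 27, 28} M M'" "M 11 = j" "M 25 = rp t" "M' 26 = n" "n < p"
  shows "M' 3 = p" "M' 11 = j" "M' 25 = rp t" "arr 3 M' = g" "arr 2 M' n = \<beta> n" "M' 29 = M 29"
proof -
  have "static M'" by (rule static_frame[OF assms(1,2)]) auto
  then show "M' 3 = p" "arr 3 M' = g" "arr 2 M' n = \<beta> n"
    using assms by (simp_all add: static_def)
  show "M' 11 = j" "M' 25 = rp t" "M' 29 = M 29"
    using assms(3,4) frame_get[OF assms(2)] by simp_all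
qed

lemma wp_scan_count:
  assumes S: "static M" "M 11 = j" "M 25 = rp ts"
    and Q: "\<And>M' t'. t' \<le> t + 18 * p + 3 \<Longrightarrow> frame {0, 23, 24, 26, 27, 28} M M' \<Longrightarrow>
      M' 24 = M 24 + length (diffs ts j) \<Longrightarrow> Q M' inp out t'"
  shows "wp (scan (Add (To_Cell 24) (Cell 24) (Const 1))) Q M inp out t"
proof -
  let ?I = "\<lambda>n M' inp' out' t'. frame {0, 23, 24, 26, 27, 28} M M' \<and> M' 26 = n \<and>
    M' 24 = M 24 + length (filter (\<lambda>q. of_bool (\<beta> q \<le> j) \<noteq> g (rp ts + q)) [0..<n]) \<and>
    inp' = inp \<and> out' = out \<and> t' \<le> t + 1 + 18 * n"
  show ?thesis
    unfolding scan_def block.simps wp_Seq wp_Move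
  proof (rule wp_loop[where n = p and I = ?I])
    fix n M' inp' out' t'
    assume n: "n < p" and I: "?I n M' inp' out' t'"
    note facts = scan_step[OF S(1) conjunct1[OF I] S(2,3) _ n]
    show "holds M' (Less (Cell 26) (Cell 3)) \<and> wp (Seq (Add (To_Cell 23) (Cell 25) (Cell 26))
       (Seq (load 27 3 23) (Seq (load 28 2 26)
         (Seq (If (Leq (Cell 28) (Cell 11)) (Move (To_Cell 28) (Const 1)) (Move (To_Cell 28) (Const 0)))
           (Seq (If (Equal (Cell 28) (Cell 27)) Skip (Add (To_Cell 24) (Cell 24) (Const 1)))
             (Add (To_Cell 26) (Cell 26) (Const 1))))))) (?I (Suc n)) M' inp' out' (t' + 1)"
      using n I facts by (auto simp: wp_simps)
  next
    fix M' inp' out' t'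
    assume I: "?I p M' inp' out' t'"
    have "static M'" by (rule static_frame[OF S(1) conjunct1[OF I]]) auto
    then have "M' 3 = p" by (simp add: static_def)
    moreover have "Q M' inp out (t' + 1)"
      by (rule Q) (use I in \<open>auto simp: diffs_def\<close>)
    ultimately show "\<not> holds M' (Less (Cell 26) (Cell 3)) \<and> Q M' inp' out' (t' + 1)"
      using I by simp
  qed (simp add: S)
qed

lemma wp_scan_write:
  assumes S: "static M" "M 11 = j" "M 25 = rp ts"
    and Q: "\<And>M' t'. t' \<le> t + 18 * p + 3 \<Longrightarrow> frame {0, 23, 24, 26, 27, 28} M M' \<Longrightarrow>
      Q M' inp (out @ concat (map (\<lambda>q. [M 29, q]) (diffs ts j))) t'"
  shows "wp (scan (block [Write (Cell 29), Write (Cell 26)])) Q M inp out t"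
proof -
  let ?I = "\<lambda>n M' inp' out' t'. frame {0, 23, 24, 26, 27, 28} M M' \<and> M' 26 = n \<and>
    inp' = inp \<and> out' = out @ concat (map (\<lambda>q. [M 29, q])
      (filter (\<lambda>q. of_bool (\<beta> q \<le> j) \<noteq> g (rp ts + q)) [0..<n])) \<and> t' \<le> t + 1 + 18 * n"
  show ?thesis
    unfolding scan_def block.simps wp_Seq wp_Move
  proof (rule wp_loop[where n = p and I = ?I])
    fix n M' inp' out' t'
    assume n: "n < p" and I: "?I n M' inp' out' t'"
    note facts = scan_step[OF S(1) conjunct1[OF I] S(2,3) _ n]
    show "holds M' (Less (Cell 26) (Cell 3)) \<and> wp (Seq (Add (To_Cell 23) (Cell 25) (Cell 26))
       (Seq (load 27 3 23) (Seq (load 28 2 26)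
         (Seq (If (Leq (Cell 28) (Cell 11)) (Move (To_Cell 28) (Const 1)) (Move (To_Cell 28) (Const 0)))
           (Seq (If (Equal (Cell 28) (Cell 27)) Skip (Seq (Write (Cell 29)) (Write (Cell 26))))
             (Add (To_Cell 26) (Cell 26) (Const 1))))))) (?I (Suc n)) M' inp' out' (t' + 1)"
      using n I facts by (auto simp: wp_simps)
  next
    fix M' inp' out' t'
    assume I: "?I p M' inp' out' t'"
    have "static M'" by (rule static_frame[OF S(1) conjunct1[OF I]]) auto
    then have "M' 3 = p" by (simp add: static_def)
    moreover have "Q M' inp (out @ concat (map (\<lambda>q. [M 29, q]) (diffs ts j))) (t' + 1)"
      by (rule Q) (use I in auto)
    ultimately show "\<not> holds M' (Less (Cell 26) (Cell 3)) \<and> Q M' inp' out' (t' + 1)"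
      using I by (simp add: diffs_def)
  qed (simp add: S)
qed

text \<open>Both kinds of move increase the index, so nodes can be solved in decreasing order, and
  \<open>N\<close> marks the progress. Border nodes are correct from the start; they are exempt from
  the threshold and carry no recorded move.\<close>

definition solved :: "nat \<Rightarrow> memory \<Rightarrow> bool" where
  "solved N M \<longleftrightarrow> (\<forall>i\<le>Suc m. \<forall>j\<le>Suc p. \<forall>x<2 ^ (2 * k).
     (m < i \<or> p < j \<or> N \<le> idx i j x \<longrightarrow> arr 4 M (idx i j x) = opt i j x) \<and>
     (i \<le> m \<and> j \<le> p \<and> N \<le> idx i j x \<longrightarrow>
       best_upto i j x (2 * k + 1) (opt i j x) (arr 5 M (idx i j x)) (arr 6 M (idx i j x))))"

lemma solved_frame: "solved N M \<Longrightarrow> frame X M M' \<Longrightarrow> X \<subseteq> {..<32} \<Longrightarrow> solved N M'"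
  by (simp add: solved_def frame_arr[of X M M'])

definition at_node :: "nat \<Rightarrow> nat \<Rightarrow> nat \<Rightarrow> memory \<Rightarrow> bool" where
  "at_node i j x M \<longleftrightarrow> i \<le> m \<and> j \<le> p \<and> x < 2 ^ (2 * k) \<and> M 10 = i \<and> M 11 = j \<and> M 12 = x \<and>
     M 13 = idx i j x"

lemma at_node_frame:
  "at_node i j x M \<Longrightarrow> frame X M M' \<Longrightarrow> X \<inter> {10..13} = {} \<Longrightarrow> at_node i j x M'"
proof -
  assume A: "at_node i j x M" and F: "frame X M M'" and X: "X \<inter> {10..13} = {}"
  have "M' r = M r" if "r \<in> {10..13}" for r
    using X that by (intro frame_get[OF F]) blast
  with A show ?thesis by (simp add: at_node_def)
qed

lemma wp_relax:
  assumes S: "static M" "at_node i j x M" "solved (Suc (idx i j x)) M"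
    and b: "M 19 = b" "b \<le> 2 * k" "free_slot x b" "M 20 = occupy x b"
    and best: "best_upto i j x b (M 14) (M 15) (M 16)"
    and Q: "\<And>M' t'. t' \<le> t + 18 * p + 30 \<Longrightarrow> frame {0, 14, 15, 16, 23, 24, 25, 26, 27, 28} M M' \<Longrightarrow>
      best_upto i j x (Suc b) (M' 14) (M' 15) (M' 16) \<Longrightarrow> Q M' inp out t'"
  shows "wp relax Q M inp out t"
proof -
  let ?o = "opt (Suc i) j (occupy x b)"
  let ?N = "idx i j x"
  have xW: "x < 2 ^ (2 * k)" and ij: "i \<le> m" "j \<le> p"
    and regs: "M 10 = i" "M 11 = j" "M 12 = x" "M 13 = ?N"
    using S(2) by (simp_all add: at_node_def)
  have st: "M 6 = (p + 2) * 2 ^ (2 * k)" "arr 7 M = rp" using S(1) by (simp_all add: static_def)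
  have "?N + (p + 2) * 2 ^ (2 * k) + occupy x b - x = idx (Suc i) j (occupy x b)"
    by (simp add: idx_def algebra_simps)
  moreover have "Suc ?N \<le> idx (Suc i) j (occupy x b)"
    using xW by (simp add: idx_def algebra_simps)
  ultimately have V: "arr 4 M (?N + (p + 2) * 2 ^ (2 * k) + occupy x b - x) = ?o"
    using S(3) ij occupy_less[OF xW b(2)] by (simp add: solved_def)
  show ?thesis
  proof (cases "?o = 0")
    case True
    have "best_upto i j x (Suc b) (M 14) (M 15) (M 16)"
      using best True by (intro best_upto_keep) (auto simp: place_def)
    then show ?thesis
      using V True by (simp add: relax_def wp_simps regs st b Q)
  next
    case False
    have pl: "place i j x b = ?o + length (diffs (i + b) j)" "place i j x b \<noteq> 0"
      using False b(3) by (simp_all add: place_def)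
    have "wp (scan (Add (To_Cell 24) (Cell 24) (Const 1)))
        (wp (If (Less (Const 0) (Cell 14))
          (If (Less (Cell 24) (Cell 14)) update_best Skip) update_best) Q) M2 inp out t2"
      if F2: "frame {0, 23, 24, 25} M M2" and M2: "M2 24 = ?o" "M2 25 = rp (i + b)"
        and t2: "t2 \<le> t + 20" for M2 t2
    proof (rule wp_scan_count[where j = j and ts = "i + b"])
      show "static M2" by (rule static_frame[OF S(1) F2]) auto
      show "M2 11 = j" using frame_get[OF F2] regs by simp
      show "M2 25 = rp (i + b)" by fact
      fix M' t' assume t': "t' \<le> t2 + 18 * p + 3" and F': "frame {0, 23, 24, 26, 27, 28} M2 M'"
        and v: "M' 24 = M2 24 + length (diffs (i + b) j)"
      have F: "frame {0, 14, 15, 16, 23, 24, 25, 26, 27, 28} M M'"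
        using F2 F' by (simp add: frame_def)
      have v': "M' 24 = place i j x b" using v M2 pl by simp
      have eqs: "M' 14 = M 14" "M' 15 = M 15" "M' 16 = M 16" "M' 19 = b" "M' 20 = occupy x b"
        using frame_get[OF F2] frame_get[OF F'] b by simp_all
      show "wp (If (Less (Const 0) (Cell 14))
          (If (Less (Cell 24) (Cell 14)) update_best Skip) update_best) Q M' inp out t'"
      proof (cases "M 14 = 0 \<or> place i j x b < M 14")
        case True
        then have "best_upto i j x (Suc b) (place i j x b) (Suc b) (occupy x b)"
          using best pl(2) by (intro best_upto_replace) auto
        then show ?thesis
          using True t' t2 by (auto simp: wp_simps update_best_def eqs v' F One_nat_def intro!: Q)
      next
        case False
        then have "best_upto i j x (Suc b) (M 14) (M 15) (M 16)"
          using best by (intro best_upto_keep) auto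
        then show ?thesis
          using False t' t2 by (auto simp: wp_simps eqs v' F intro!: Q)
      qed
    qed
    then show ?thesis
      using V False by (simp add: relax_def wp_simps regs st b)
  qed
qed

text \<open>The factor 9 is 3 + 6: halving \<open>x div 2 ^ b\<close> costs about 3 * 4^k steps at
  most, halving \<open>x + 2 ^ b\<close> twice as much.\<close>

lemma wp_try_place:
  assumes S: "static M" "at_node i j x M" "solved (Suc (idx i j x)) M"
    and b: "M 19 = b" "b \<le> 2 * k" "M 17 = x div 2 ^ b" "M 18 = 2 ^ b"
    and best: "best_upto i j x b (M 14) (M 15) (M 16)"
    and Q: "\<And>M' t'. t' \<le> t + 9 * 2 ^ (2 * k) + 18 * p + 50 \<Longrightarrow> frame (insert 0 {14..<30}) M M' \<Longrightarrow>
      M' 17 = x div 2 ^ Suc b \<Longrightarrow> M' 18 = 2 ^ Suc b \<Longrightarrow> M' 19 = Suc b \<Longrightarrow>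
      best_upto i j x (Suc b) (M' 14) (M' 15) (M' 16) \<Longrightarrow> Q M' inp out t'"
  shows "wp try_place Q M inp out t"
proof -
  let ?z = "x div 2 ^ b"
  let ?tail = "wp next_bit Q"
  have x: "x < 2 ^ (2 * k)" "M 12 = x" using S(2) by (simp_all add: at_node_def)
  have z: "?z \<le> x" by (rule div_le_dividend)
  have z2: "?z div 2 = x div 2 ^ Suc b" by (simp add: div_mult2_eq[symmetric] mult.commute)
  have pow: "2 ^ b \<le> (2::nat) ^ (2 * k)" using b(2) by (intro power_increasing) auto
  have tail: "?tail M' inp out t'"
    if F: "frame (insert 0 ({14..<30} - {18, 19})) M M'" and "M' 17 = ?z div 2"
      and "best_upto i j x (Suc b) (M' 14) (M' 15) (M' 16)"
      and "t' \<le> t + 9 * 2 ^ (2 * k) + 18 * p + 48" for M' t'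
  proof -
    have "M' 18 = 2 ^ b" "M' 19 = b" using frame_get[OF F] b by simp_all
    moreover have "frame (insert 0 {14..<30}) M M'" using F by (auto simp: frame_def)
    ultimately show ?thesis using that z2 by (auto simp: next_bit_def wp_simps intro!: Q)
  qed
  show ?thesis
    unfolding try_place_def block.simps wp_Seq
  proof (rule wp_halve)
    show "(17::nat) \<notin> {20, 21}" by simp
    fix t1 assume "t1 \<le> t + 3 * M 17 + 3"
    then have t1: "t1 \<le> t + 3 * 2 ^ (2 * k) + 3" using b(3) z x(1) by linarith
    show "wp (Move (To_Cell 17) (Cell 20))
         (wp (If (Equal (Cell 21) (Const 0))
           (Seq (Add (To_Cell 22) (Cell 12) (Cell 18)) (Seq (halve 22)
             (If (Equal (Cell 21) (Const 1)) relax Skip))) Skip) ?tail)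
         (M(20 := M 17 div 2, 21 := M 17 mod 2)) inp out t1"
    proof (cases "bit x b")
      case True
      then have "place i j x b = 0" by (simp add: place_def free_slot_def)
      then have B: "best_upto i j x (Suc b) (M 14) (M 15) (M 16)"
        using best by (intro best_upto_keep) auto
      from True have "?z mod 2 = 1" by (simp add: bit_iff_odd odd_iff_mod_2_eq_one)
      then show ?thesis
        using t1 B by (simp add: wp_Move wp_If wp_Skip wp_Seq b) (rule tail, auto)
    next
      case False
      then have "?z mod 2 = 0" by (simp add: bit_iff_odd even_iff_mod_2_eq_zero)
      moreover have "wp (halve 22) (wp (If (Equal (Cell 21) (Const 1)) relax Skip) ?tail) M2 inp out t2"
        if F2: "frame {17, 20, 21, 22} M M2" and M2: "M2 17 = ?z div 2" "M2 22 = x + 2 ^ b"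
          and t2: "t2 \<le> t1 + 3" for M2 t2
      proof (rule wp_halve)
        show "(22::nat) \<notin> {20, 21}" by simp
        fix t3 assume "t3 \<le> t2 + 3 * M2 22 + 3"
        then have t3: "t3 \<le> t1 + 6 * 2 ^ (2 * k) + 6" using M2(2) t2 pow x(1) by linarith
        let ?M3 = "M2(20 := M2 22 div 2, 21 := M2 22 mod 2)"
        have F3: "frame {17, 20, 21, 22} M ?M3" using F2 by simp
        have eqs: "?M3 14 = M 14" "?M3 15 = M 15" "?M3 16 = M 16" "?M3 19 = b"
          using frame_get[OF F3] b by simp_all
        have tail': "?tail M' inp out t'"
          if F: "frame {0, 14, 15, 16, 23, 24, 25, 26, 27, 28} ?M3 M'"
            and B: "best_upto i j x (Suc b) (M' 14) (M' 15) (M' 16)"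
            and t': "t' \<le> t3 + 18 * p + 32" for M' t'
        proof (rule tail[OF _ _ B])
          show "frame (insert 0 ({14..<30} - {18, 19})) M M'"
            using F F3 by (auto simp: frame_def)
          show "M' 17 = ?z div 2" using frame_get[OF F] M2 by simp
        qed (use t' t3 t1 in simp)
        show "wp (If (Equal (Cell 21) (Const 1)) relax Skip) ?tail ?M3 inp out t3"
        proof (cases "odd (x + 2 ^ b)")
          case True
          with False have free: "free_slot x b" by (simp add: free_slot_def)
          have "wp relax ?tail ?M3 inp out (t3 + 1)"
          proof (rule wp_relax[where i = i and j = j and x = x and b = b])
            show "static ?M3" by (rule static_frame[OF S(1) F3]) auto
            show "at_node i j x ?M3" by (rule at_node_frame[OF S(2) F3]) auto
            show "solved (Suc (idx i j x)) ?M3" by (rule solved_frame[OF S(3) F3]) auto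
            show "?M3 20 = occupy x b" using M2 by (simp add: occupy_def)
            show "best_upto i j x b (?M3 14) (?M3 15) (?M3 16)" using best unfolding eqs .
          qed (use eqs b free in \<open>auto intro!: tail'\<close>)
          moreover have "(x + 2 ^ b) mod 2 = 1" using True by (simp only: odd_iff_mod_2_eq_one)
          ultimately show ?thesis by (simp add: wp_If M2)
        next
          case odd: False
          then have "place i j x b = 0" by (simp add: place_def free_slot_def)
          then have "best_upto i j x (Suc b) (?M3 14) (?M3 15) (?M3 16)"
            unfolding eqs using best by (intro best_upto_keep) auto
          then have "?tail ?M3 inp out (t3 + 1 + 1)" by (intro tail') auto
          moreover have "(x + 2 ^ b) mod 2 = 0" using odd by (simp only: even_iff_mod_2_eq_zero not_not)
          ultimately show ?thesis by (simp add: wp_If wp_Skip M2)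
        qed
      qed
      ultimately show ?thesis
        by (simp add: wp_Move wp_If wp_Seq wp_Add b x)
    qed
  qed
qed

end

section \<open>Sweeping through all nodes and tracing an optimal schedule\<close>

text \<open>Positions, levels and masks run downwards and cell 13 follows by subtraction. On
  entering a position, subtracting \<open>W\<close> jumps over the extra level \<open>p + 1\<close>,
  which is never computed.\<close>

definition sweep :: program where
  "sweep = While (Less (Const 0) (Cell 10)) (block
     [Sub (To_Cell 10) (Cell 10) (Const 1),
      Sub (To_Cell 13) (Cell 13) (Cell 5),
      Add (To_Cell 11) (Cell 3) (Const 1),
      While (Less (Const 0) (Cell 11)) (block
        [Sub (To_Cell 11) (Cell 11) (Const 1),
         Move (To_Cell 12) (Cell 5),
         While (Less (Const 0) (Cell 12)) (block
           [Sub (To_Cell 12) (Cell 12) (Const 1),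
            Sub (To_Cell 13) (Cell 13) (Const 1),
            solve_node])])])"

definition write_edits :: program where
  "write_edits = scan (block [Write (Cell 29), Write (Cell 26)])"

definition trace_step :: program where
  "trace_step = block
     [load 15 5 13,
      If (Equal (Cell 15) (Const 0)) (block
        [Add (To_Cell 11) (Cell 11) (Const 1),
         Add (To_Cell 13) (Cell 13) (Cell 5)])
      (block
        [Sub (To_Cell 15) (Cell 15) (Const 1),
         Add (To_Cell 23) (Cell 10) (Cell 15),
         load 29 0 23,
         load 25 7 23,
         write_edits,
         load 16 6 13,
         Add (To_Cell 13) (Cell 13) (Cell 6),
         Add (To_Cell 13) (Cell 13) (Cell 16),
         Sub (To_Cell 13) (Cell 13) (Cell 12),
         Move (To_Cell 12) (Cell 16),
         Add (To_Cell 10) (Cell 10) (Const 1)])]"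

definition trace :: program where
  "trace = block
     [Move (To_Cell 10) (Const 0),
      Move (To_Cell 11) (Const 0),
      Move (To_Cell 12) (Cell 7),
      Move (To_Cell 13) (Cell 7),
      While (Less (Cell 13) (Cell 9)) trace_step]"

context tables
begin

text \<open>Uniqueness of mixed-radix digits: \<open>x\<close> is the remainder modulo 4^k, then
  \<open>j\<close> the remainder modulo \<open>p + 2\<close>.\<close>

lemma idx_inject:
  assumes "j \<le> Suc p" "j' \<le> Suc p" "x < 2 ^ (2 * k)" "x' < 2 ^ (2 * k)"
  shows "idx i j x = idx i' j' x' \<longleftrightarrow> i = i' \<and> j = j' \<and> x = x'"
proof
  assume eq: "idx i j x = idx i' j' x'"
  have "(i * (p + 2) + j) = idx i j x div 2 ^ (2 * k)" "x = idx i j x mod 2 ^ (2 * k)"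
    "(i' * (p + 2) + j') = idx i' j' x' div 2 ^ (2 * k)" "x' = idx i' j' x' mod 2 ^ (2 * k)"
    using assms(3,4) by (simp_all add: idx_def)
  then have x: "x = x'" and a: "i * (p + 2) + j = i' * (p + 2) + j'" using eq by simp_all
  have "i = (i * (p + 2) + j) div (p + 2)" "i' = (i' * (p + 2) + j') div (p + 2)"
    using assms(1,2) div_mult_self1[of "p + 2" j i] div_mult_self1[of "p + 2" j' i']
    by (simp_all add: add.commute)
  with a have "i = i'" by simp
  with a x show "i = i' \<and> j = j' \<and> x = x'" by simp
qed auto

definition node_time :: nat where
  "node_time = (2 * k + 1) * (9 * 2 ^ (2 * k) + 18 * p + 51) + 40"

lemma wp_solve_node:
  assumes S: "static M" "at_node i j x M" "solved (Suc (idx i j x)) M"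
    and Q: "\<And>M' t'. t' \<le> t + node_time \<Longrightarrow> static M' \<Longrightarrow> at_node i j x M' \<Longrightarrow>
      solved (idx i j x) M' \<Longrightarrow> Q M' inp out t'"
  shows "wp solve_node Q M inp out t"
proof -
  let ?N = "idx i j x" and ?X = "insert 0 {14..<30} :: nat set"
  let ?c = "9 * 2 ^ (2 * k) + 18 * p + 51"
  let ?I = "\<lambda>b M' inp' out' t'. frame ?X M M' \<and> M' 17 = x div 2 ^ b \<and> M' 18 = 2 ^ b \<and> M' 19 = b \<and>
    best_upto i j x b (M' 14) (M' 15) (M' 16) \<and> inp' = inp \<and> out' = out \<and> t' \<le> t + 11 + b * ?c"
  have X: "?X \<subseteq> insert 0 {10..<32}" "?X \<inter> {10..13} = {}" "?X \<subseteq> {..<32}" by auto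
  have x: "x < 2 ^ (2 * k)" and ij: "i \<le> m" "j \<le> p"
    and regs: "M 10 = i" "M 11 = j" "M 12 = x" "M 13 = ?N"
    using S(2) by (simp_all add: at_node_def)
  have "?N + 2 ^ (2 * k) = idx i (Suc j) x" by (simp add: idx_def algebra_simps)
  moreover have "Suc ?N \<le> idx i (Suc j) x" by (simp add: idx_def algebra_simps)
  ultimately have V: "arr 4 M (?N + 2 ^ (2 * k)) = opt i (Suc j) x" "M 5 = 2 ^ (2 * k)"
    using S(1,3) ij x by (simp_all add: solved_def static_def)
  have loop: "wp (While (Less (Cell 19) (Cell 8)) try_place)
      (wp record_best Q) M1 inp out t1"
    if I0: "?I 0 M1 inp out t1" for M1 t1
  proof (rule wp_loop[where n = "2 * k + 1" and I = ?I])
    show "?I 0 M1 inp out t1" by (rule I0)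
  next
    fix b M' inp' out' t'
    assume b: "b < 2 * k + 1" and I: "?I b M' inp' out' t'"
    note F = conjunct1[OF I]
    have S': "static M'" "at_node i j x M'" "solved (Suc ?N) M'"
      by (rule static_frame[OF S(1) F X(1)] at_node_frame[OF S(2) F X(2)] solved_frame[OF S(3) F X(3)])+
    have "wp try_place (?I (Suc b)) M' inp out (t' + 1)"
    proof (rule wp_try_place[OF S'])
      fix M'' t'' assume "frame ?X M' M''" "t'' \<le> t' + 1 + 9 * 2 ^ (2 * k) + 18 * p + 50"
        "M'' 17 = x div 2 ^ Suc b" "M'' 18 = 2 ^ Suc b" "M'' 19 = Suc b"
        "best_upto i j x (Suc b) (M'' 14) (M'' 15) (M'' 16)"
      with I show "?I (Suc b) M'' inp out t''" by (auto simp: frame_def)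
    qed (use I b in auto)
    with I b S'(1) show "holds M' (Less (Cell 19) (Cell 8)) \<and>
        wp try_place (?I (Suc b)) M' inp' out' (t' + 1)"
      by (simp add: static_def)
  next
    fix M' inp' out' t'
    assume I: "?I (2 * k + 1) M' inp' out' t'"
    note F = conjunct1[OF I]
    have S': "static M'" "at_node i j x M'" "solved (Suc ?N) M'"
      by (rule static_frame[OF S(1) F X(1)] at_node_frame[OF S(2) F X(2)] solved_frame[OF S(3) F X(3)])+
    have best: "best_upto i j x (2 * k + 1) (M' 14) (M' 15) (M' 16)" using I by simp
    have v: "M' 14 = opt i j x" by (rule best_upto_opt[OF best ij(2)])
    have N: "M' 13 = ?N" using S'(2) by (simp add: at_node_def)
    \<comment> \<open>36, 37 and 38 are 32 plus the array number: each store leaves its address in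
      cell 0.\<close>
    define M'' where "M'' = upd 6 ?N (M' 16) ((upd 5 ?N (M' 15)
      ((upd 4 ?N (M' 14) (M'(0 := 36 + 8 * ?N)))(0 := 37 + 8 * ?N)))(0 := 38 + 8 * ?N))"
    have regs'': "M'' r = M' r" if "r \<noteq> 0" "r < 32" for r using that by (simp add: M''_def)
    have arrs: "arr 4 M'' = (arr 4 M')(?N := M' 14)" "arr 5 M'' = (arr 5 M')(?N := M' 15)"
      "arr 6 M'' = (arr 6 M')(?N := M' 16)" "arr 0 M'' = arr 0 M'" "arr 7 M'' = arr 7 M'"
      "arr 2 M'' = arr 2 M'" "arr 3 M'' = arr 3 M'"
      by (simp_all add: M''_def)
    have "static M''" using S'(1) by (simp add: static_def regs'' arrs)
    moreover have "at_node i j x M''" using S'(2) by (simp add: at_node_def regs'')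
    moreover have "solved ?N M''"
      unfolding solved_def
    proof (intro allI impI)
      fix i' j' x' :: nat assume i': "i' \<le> Suc m" "j' \<le> Suc p" "x' < 2 ^ (2 * k)"
      have eq: "idx i' j' x' = ?N \<longleftrightarrow> i' = i \<and> j' = j \<and> x' = x"
        using i' ij x by (intro idx_inject) auto
      show "(m < i' \<or> p < j' \<or> ?N \<le> idx i' j' x' \<longrightarrow> arr 4 M'' (idx i' j' x') = opt i' j' x') \<and>
        (i' \<le> m \<and> j' \<le> p \<and> ?N \<le> idx i' j' x' \<longrightarrow> best_upto i' j' x' (2 * k + 1) (opt i' j' x')
          (arr 5 M'' (idx i' j' x')) (arr 6 M'' (idx i' j' x')))"
      proof (cases "i' = i \<and> j' = j \<and> x' = x")
        case True
        then show ?thesis using best v ij by (simp add: arrs)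
      next
        case False
        with eq have "idx i' j' x' \<noteq> ?N" by simp
        moreover from this have "?N \<le> idx i' j' x' \<longleftrightarrow> Suc ?N \<le> idx i' j' x'" by auto
        ultimately show ?thesis using S'(3) i' by (simp add: arrs solved_def)
      qed
    qed
    moreover have "t' + 16 \<le> t + node_time" using I by (simp add: node_time_def algebra_simps)
    ultimately have "Q M'' inp out (t' + 16)" by (intro Q)
    then have "wp record_best Q M' inp out (t' + 1)"
      by (simp add: record_best_def wp_simps N M''_def ac_simps)
    moreover have "M' 8 = 2 * k + 1" using S'(1) by (simp add: static_def)
    ultimately show "\<not> holds M' (Less (Cell 19) (Cell 8)) \<and>
       wp record_best Q M' inp' out' (t' + 1)"
      using I by simp
  qed
  show ?thesis
    unfolding solve_node_def block.simps
    by (simp add: wp_simps regs V) (rule loop, simp add: best_upto_0)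
qed

end

context tables
begin

lemma static_reg [simp]: "r \<in> insert 0 {10..<32} \<Longrightarrow> static (M(r := v)) \<longleftrightarrow> static M"
  by (auto simp: static_def)

lemma solved_reg [simp]: "r < 32 \<Longrightarrow> solved N (M(r := v)) \<longleftrightarrow> solved N M"
  by (simp add: solved_def)

definition row_time :: nat where
  "row_time = 2 ^ (2 * k) * (node_time + 3)"

lemma wp_row:
  assumes S: "static M" "solved (idx i (Suc j) 0) M" and ij: "i \<le> m" "j \<le> p"
    and regs: "M 10 = i" "M 11 = j" "M 12 = 2 ^ (2 * k)" "M 13 = idx i (Suc j) 0"
    and Q: "\<And>M' t'. t' \<le> t + row_time + 1 \<Longrightarrow> static M' \<Longrightarrow> solved (idx i j 0) M' \<Longrightarrow> M' 10 = i \<Longrightarrow>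
      M' 11 = j \<Longrightarrow> M' 13 = idx i j 0 \<Longrightarrow> Q M' inp out t'"
  shows "wp (While (Less (Const 0) (Cell 12)) (block
           [Sub (To_Cell 12) (Cell 12) (Const 1),
            Sub (To_Cell 13) (Cell 13) (Const 1),
            solve_node])) Q M inp out t"
proof -
  let ?W = "2 ^ (2 * k) :: nat"
  let ?I = "\<lambda>n M' inp' out' t'. static M' \<and> solved (idx i j (?W - n)) M' \<and> M' 10 = i \<and> M' 11 = j \<and>
    M' 12 = ?W - n \<and> M' 13 = idx i j (?W - n) \<and> inp' = inp \<and> out' = out \<and> t' \<le> t + n * (node_time + 3)"
  show ?thesis
  proof (rule wp_loop[where n = ?W and I = ?I])
    have "idx i (Suc j) 0 = idx i j ?W" by (simp add: idx_def)
    then show "?I 0 M inp out t" using S regs by simp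
  next
    fix n M' inp' out' t'
    assume n: "n < ?W" and I: "?I n M' inp' out' t'"
    define x where "x = ?W - Suc n"
    have x: "?W - n = Suc x" "x < ?W" using n by (auto simp: x_def)
    have idx: "idx i j (Suc x) = Suc (idx i j x)" by (simp add: idx_def)
    let ?M = "M'(12 := x, 13 := idx i j x)"
    have "wp solve_node (?I (Suc n)) ?M inp out (t' + 3)"
    proof (rule wp_solve_node[where i = i and j = j and x = x])
      show "static ?M" using I by simp
      show "at_node i j x ?M" using I ij x by (simp add: at_node_def)
      show "solved (Suc (idx i j x)) ?M" using I by (simp add: x idx)
      fix M'' t'' assume "t'' \<le> t' + 3 + node_time" "static M''" "at_node i j x M''"
        "solved (idx i j x) M''"
      then show "?I (Suc n) M'' inp out t''" using I by (auto simp: x_def at_node_def algebra_simps)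
    qed
    then show "holds M' (Less (Const 0) (Cell 12)) \<and> wp (block
           [Sub (To_Cell 12) (Cell 12) (Const 1), Sub (To_Cell 13) (Cell 13) (Const 1), solve_node])
         (?I (Suc n)) M' inp' out' (t' + 1)"
      using I by (simp add: wp_simps x idx numeral_3_eq_3 One_nat_def)
  next
    fix M' inp' out' t'
    assume I: "?I ?W M' inp' out' t'"
    have "Q M' inp out (t' + 1)" by (rule Q) (use I in \<open>auto simp: row_time_def\<close>)
    then show "\<not> holds M' (Less (Const 0) (Cell 12)) \<and> Q M' inp' out' (t' + 1)" using I by simp
  qed
qed

text \<open>Between the two indices lie only nodes of level \<open>p + 1\<close>, which are correct
  without being computed.\<close>

lemma solved_skip_row:
  assumes "solved (idx (Suc i) 0 0) M"
  shows "solved (idx i (Suc p) 0) M"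
proof -
  have "idx (Suc i) 0 0 \<le> idx i' j' x'"
    if "j' \<le> p" "x' < 2 ^ (2 * k)" "idx i (Suc p) 0 \<le> idx i' j' x'" for i' j' x'
  proof -
    have "i < i'"
    proof (rule ccontr)
      assume "\<not> i < i'"
      then have "i' * (p + 2) + j' + 1 \<le> i * (p + 2) + Suc p"
        using mult_le_mono1[of i' i "p + 2"] that(1) by simp
      then have "(i' * (p + 2) + j' + 1) * 2 ^ (2 * k) \<le> (i * (p + 2) + Suc p) * 2 ^ (2 * k)"
        by (rule mult_le_mono1)
      with that(2,3) show False by (simp add: idx_def algebra_simps)
    qed
    then have "Suc i * (p + 2) \<le> i' * (p + 2)" by (intro mult_le_mono1) simp
    then have "Suc i * (p + 2) * 2 ^ (2 * k) \<le> (i' * (p + 2) + j') * 2 ^ (2 * k)"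
      by (intro mult_le_mono1) simp
    then show ?thesis by (simp add: idx_def)
  qed
  with assms show ?thesis unfolding solved_def by (meson not_le)
qed

lemma wp_sweep:
  assumes S: "static M" "solved (idx (Suc m) 0 0) M" and regs: "M 10 = Suc m" "M 13 = idx (Suc m) 0 0"
    and Q: "\<And>M' t'. t' \<le> t + Suc m * (Suc p * (row_time + 4) + 5) + 1 \<Longrightarrow> static M' \<Longrightarrow> solved 0 M' \<Longrightarrow>
      Q M' inp out t'"
  shows "wp sweep Q M inp out t"
proof -
  let ?c = "Suc p * (row_time + 4) + 5"
  let ?I = "\<lambda>n M' inp' out' t'. static M' \<and> solved (idx (Suc m - n) 0 0) M' \<and> M' 10 = Suc m - n \<and>
    M' 13 = idx (Suc m - n) 0 0 \<and> inp' = inp \<and> out' = out \<and> t' \<le> t + n * ?c"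
  show ?thesis
    unfolding sweep_def
  proof (rule wp_loop[where n = "Suc m" and I = ?I])
    show "?I 0 M inp out t" using S regs by simp
  next
    fix n M' inp' out' t'
    assume n: "n < Suc m" and I: "?I n M' inp' out' t'"
    define i where "i = m - n"
    have i: "Suc m - n = Suc i" "i \<le> m" using n by (auto simp: i_def)
    have st: "M' 3 = p" "M' 5 = 2 ^ (2 * k)" using I by (auto simp: static_def)
    have idx: "idx (Suc i) 0 0 - 2 ^ (2 * k) = idx i (Suc p) 0" by (simp add: idx_def algebra_simps)
    let ?J = "\<lambda>n M' inp' out' t2. static M' \<and> solved (idx i (Suc p - n) 0) M' \<and> M' 10 = i \<and>
      M' 11 = Suc p - n \<and> M' 13 = idx i (Suc p - n) 0 \<and> inp' = inp \<and> out' = out \<and>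
      t2 \<le> t' + 4 + n * (row_time + 4)"
    have "wp (While (Less (Const 0) (Cell 11)) (block
        [Sub (To_Cell 11) (Cell 11) (Const 1),
         Move (To_Cell 12) (Cell 5),
         While (Less (Const 0) (Cell 12)) (block
           [Sub (To_Cell 12) (Cell 12) (Const 1),
            Sub (To_Cell 13) (Cell 13) (Const 1),
            solve_node])])) (?I (Suc n)) M1 inp out t1"
      if J0: "?J 0 M1 inp out t1" for M1 t1
    proof (rule wp_loop[where n = "Suc p" and I = ?J])
      show "?J 0 M1 inp out t1" by (rule J0)
    next
      fix n M2 inp2 out2 t2
      assume n: "n < Suc p" and J: "?J n M2 inp2 out2 t2"
      define j where "j = p - n"
      have j: "Suc p - n = Suc j" "j \<le> p" using n by (auto simp: j_def)
      have M5: "M2 5 = 2 ^ (2 * k)" using J by (auto simp: static_def)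
      have "wp (While (Less (Const 0) (Cell 12)) (block
           [Sub (To_Cell 12) (Cell 12) (Const 1),
            Sub (To_Cell 13) (Cell 13) (Const 1),
            solve_node])) (?J (Suc n)) (M2(11 := j, 12 := 2 ^ (2 * k))) inp out (t2 + 1 + 1 + 1)"
        by (rule wp_row[where i = i and j = j]) (use J i j in \<open>auto simp: j_def algebra_simps\<close>)
      then show "holds M2 (Less (Const 0) (Cell 11)) \<and> wp (block
        [Sub (To_Cell 11) (Cell 11) (Const 1),
         Move (To_Cell 12) (Cell 5),
         While (Less (Const 0) (Cell 12)) (block
           [Sub (To_Cell 12) (Cell 12) (Const 1),
            Sub (To_Cell 13) (Cell 13) (Const 1),
            solve_node])]) (?J (Suc n)) M2 inp2 out2 (t2 + 1)"
        using J by (simp add: wp_Seq wp_Sub wp_Move j M5)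
    next
      fix M2 inp2 out2 t2
      assume J: "?J (Suc p) M2 inp2 out2 t2"
      then show "\<not> holds M2 (Less (Const 0) (Cell 11)) \<and> ?I (Suc n) M2 inp2 out2 (t2 + 1)"
        using I by (auto simp: i_def)
    qed
    moreover have "?J 0 (M'(10 := i, 13 := idx i (Suc p) 0, 11 := Suc p)) inp out (t' + 1 + 1 + 1 + 1)"
      using I solved_skip_row[of i M'] by (simp add: i)
    ultimately show "holds M' (Less (Const 0) (Cell 10)) \<and> wp (block
     [Sub (To_Cell 10) (Cell 10) (Const 1),
      Sub (To_Cell 13) (Cell 13) (Cell 5),
      Add (To_Cell 11) (Cell 3) (Const 1),
      While (Less (Const 0) (Cell 11)) (block
        [Sub (To_Cell 11) (Cell 11) (Const 1),
         Move (To_Cell 12) (Cell 5),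
         While (Less (Const 0) (Cell 12)) (block
           [Sub (To_Cell 12) (Cell 12) (Const 1),
            Sub (To_Cell 13) (Cell 13) (Const 1),
            solve_node])])]) (?I (Suc n)) M' inp' out' (t' + 1)"
      using I by (simp add: wp_Seq wp_Sub wp_Add i st idx)
  next
    fix M' inp' out' t'
    assume I: "?I (Suc m) M' inp' out' t'"
    have "Q M' inp out (t' + 1)" by (rule Q) (use I in \<open>auto simp: idx_def\<close>)
    then show "\<not> holds M' (Less (Const 0) (Cell 10)) \<and> Q M' inp' out' (t' + 1)" using I by simp
  qed
qed

end

section \<open>Reading off an optimal schedule forwards\<close>

definition flatten :: "(nat \<times> nat) list \<Rightarrow> nat list" where
  "flatten fs = concat (map (\<lambda>(s, q). [s, q]) fs)"

context tables
begin

definition trace_time :: nat where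
  "trace_time = (m + p + 1) * (18 * p + 40) + 5"

lemma idx_less_sink:
  assumes "i \<le> m" "j \<le> p" "x < 2 ^ (2 * k)"
  shows "idx i j x < idx m (Suc p) y"
proof -
  have "i * (p + 2) + j + 1 \<le> m * (p + 2) + Suc p"
    using mult_le_mono1[of i m "p + 2"] assms(1,2) by simp
  then have "(i * (p + 2) + j + 1) * 2 ^ (2 * k) \<le> (m * (p + 2) + Suc p) * 2 ^ (2 * k)"
    by (rule mult_le_mono1)
  with assms(3) show ?thesis by (simp add: idx_def algebra_simps)
qed

text \<open>The prefix \<open>T\<close> is not stored: its edits are already in the output, and its
  validity is expressed by what it makes of any completion of the current node. Cost spent plus
  cost-to-go stays at the optimum.\<close>

definition traced :: "nat list \<Rightarrow> nat \<Rightarrow> nat \<Rightarrow> nat \<Rightarrow> bool" where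
  "traced out i j x \<longleftrightarrow> i \<le> m \<and> j \<le> Suc p \<and> x < 2 ^ (2 * k) \<and> opt i j x \<noteq> 0 \<and>
     (\<exists>T. out = flatten (edits T) \<and> total T + opt i j x = opt 0 0 (2 ^ k - 1) \<and>
       (\<forall>T'. completes i j x T' \<longrightarrow> completes 0 0 (2 ^ k - 1) (T @ T')))"

lemma traced_raise:
  assumes "traced out i j x" "opt i j x = opt i (Suc j) x" "j \<le> p"
  shows "traced out i (Suc j) x"
  using assms completes_mono[of i "Suc j" x _ j] by (auto simp: traced_def)

lemma traced_place:
  assumes tr: "traced out i j x" and b: "b < 2 * k + 1" "free_slot x b" and j: "j \<le> p"
    and y: "y = occupy x b" "opt (Suc i) j y \<noteq> 0"
    and v: "opt i j x = opt (Suc i) j y + length (diffs (i + b) j)"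
  shows "traced (out @ concat (map (\<lambda>q. [sl (i + b), q]) (diffs (i + b) j))) (Suc i) j y"
proof -
  from tr obtain T where T: "out = flatten (edits T)" "total T + opt i j x = opt 0 0 (2 ^ k - 1)"
    "\<And>T'. completes i j x T' \<Longrightarrow> completes 0 0 (2 ^ k - 1) (T @ T')"
    and i: "i \<le> m" and x: "x < 2 ^ (2 * k)"
    by (auto simp: traced_def)
  have "i \<noteq> m" using y(2) opt_beyond[of "Suc i" j y] by auto
  moreover have "y < 2 ^ (2 * k)" using occupy_less[OF x, of b] b(1) y(1) by simp
  moreover have "out @ concat (map (\<lambda>q. [sl (i + b), q]) (diffs (i + b) j)) =
      flatten (edits (T @ [(i + b, j)]))"
    using T(1) by (simp add: edits_def flatten_def comp_def)
  moreover have "total (T @ [(i + b, j)]) + opt (Suc i) j y = opt 0 0 (2 ^ k - 1)"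
    using T(2) v by (simp add: total_def)
  moreover have "completes 0 0 (2 ^ k - 1) ((T @ [(i + b, j)]) @ T')" if "completes (Suc i) j y T'" for T'
    using T(3)[of "(i + b, j) # T'"] that b j y(1) by auto
  ultimately show ?thesis using i j y(2) unfolding traced_def by (metis Suc_leI le_SucI le_neq_implies_less)
qed

lemma wp_trace:
  assumes S: "static M" "solved 0 M" and nz: "opt 0 0 (2 ^ k - 1) \<noteq> 0"
    and Q: "\<And>M' t' T. t' \<le> t + trace_time \<Longrightarrow> completes 0 0 (2 ^ k - 1) T \<Longrightarrow>
      opt 0 0 (2 ^ k - 1) = Suc (total T) \<Longrightarrow> Q M' inp (flatten (edits T)) t'"
  shows "wp trace Q M inp [] t"
proof -
  let ?c = "18 * p + 40"
  let ?I = "\<lambda>n M' inp' out' t'. static M' \<and> solved 0 M' \<and> inp' = inp \<and> t' \<le> t + 4 + n * ?c \<and>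
    (\<exists>i j x. M' 10 = i \<and> M' 11 = j \<and> M' 12 = x \<and> M' 13 = idx i j x \<and> i + j = n \<and> traced out' i j x)"
  have M7: "M 7 = 2 ^ k - 1" using S by (simp add: static_def)
  have "(2::nat) ^ k \<le> 2 ^ (2 * k)" by (intro power_increasing) auto
  then have mask: "2 ^ k - 1 < (2::nat) ^ (2 * k)"
    by (metis diff_less less_le_trans less_numeral_extra(1) zero_less_numeral zero_less_power)
  have loop: "wp (While (Less (Cell 13) (Cell 9)) trace_step) Q M1 inp [] t1"
    if I0: "?I 0 M1 inp [] t1" for M1 t1
  \<comment> \<open>Every round makes one move, and \<open>i + j\<close> counts them:
    \<open>m\<close> placements and \<open>p + 1\<close> raises.\<close>
  proof (rule wp_loop[where n = "m + p + 1" and I = ?I])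
    show "?I 0 M1 inp [] t1" by (rule I0)
  next
    fix n M' inp' out' t'
    assume n: "n < m + p + 1" and I: "?I n M' inp' out' t'"
    then obtain i j x where regs: "M' 10 = i" "M' 11 = j" "M' 12 = x" "M' 13 = idx i j x"
      and ij: "i + j = n" and tr: "traced out' i j x" by blast
    have b: "i \<le> m" "x < 2 ^ (2 * k)" "opt i j x \<noteq> 0" "j \<le> Suc p" using tr by (auto simp: traced_def)
    \<comment> \<open>On the extra level only the final node has a finite value, and there
      \<open>i + j\<close> would already be \<open>m + p + 1\<close>.\<close>
    have j: "j \<le> p"
    proof (rule ccontr)
      assume "\<not> j \<le> p"
      with b have "j = Suc p" by simp
      with opt_beyond[of i j x] b have "i = m" by (auto split: if_splits)
      with ij n \<open>j = Suc p\<close> show False by simp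
    qed
    have st: "M' 9 = idx m (Suc p) (2 ^ k - 1)" "M' 5 = 2 ^ (2 * k)" "M' 6 = (p + 2) * 2 ^ (2 * k)"
      "arr 0 M' = sl" "arr 7 M' = rp"
      using I by (auto simp: static_def)
    let ?ch = "arr 5 M' (idx i j x)" and ?y = "arr 6 M' (idx i j x)"
    have best: "best_upto i j x (2 * k + 1) (opt i j x) ?ch ?y"
      using I b j by (simp add: solved_def)
    have "wp trace_step (?I (Suc n)) M' inp out' (t' + 1)"
      using best b(3)
    proof (cases rule: best_upto_choice)
      case 1
      then have "traced out' i (Suc j) x" using traced_raise[OF tr _ j] by simp
      moreover have "idx i j x + 2 ^ (2 * k) = idx i (Suc j) x" by (simp add: idx_def)
      ultimately show ?thesis
        using I 1 ij by (simp add: trace_step_def wp_simps regs st algebra_simps One_nat_def)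
    next
      case (2 b)
      let ?y = "arr 6 M' (idx i j x)"
      let ?out = "out' @ concat (map (\<lambda>q. [sl (i + b), q]) (diffs (i + b) j))"
      let ?tail = "wp (Seq (load 16 6 13)
         (Seq (Add (To_Cell 13) (Cell 13) (Cell 6))
         (Seq (Add (To_Cell 13) (Cell 13) (Cell 16))
         (Seq (Sub (To_Cell 13) (Cell 13) (Cell 12))
         (Seq (Move (To_Cell 12) (Cell 16))
         (Add (To_Cell 10) (Cell 10) (Const 1))))))) (?I (Suc n))"
      have tr': "traced ?out (Suc i) j ?y" by (rule traced_place[OF tr 2(1,4) j 2(3,5,6)])
      have idx: "idx i j x + (p + 2) * 2 ^ (2 * k) + ?y - x = idx (Suc i) j ?y"
        by (simp add: idx_def algebra_simps)
      have "wp write_edits ?tail M2 inp out' t2"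
        if F2: "frame {0, 15, 23, 25, 29} M' M2" and M2: "M2 29 = sl (i + b)" "M2 25 = rp (i + b)"
          and t2: "t2 \<le> t' + 22" for M2 t2
        unfolding write_edits_def
      proof (rule wp_scan_write[where j = j and ts = "i + b"])
        show "static M2" by (rule static_frame[OF conjunct1[OF I] F2]) auto
        show "M2 11 = j" using frame_get[OF F2] regs by simp
        show "M2 25 = rp (i + b)" by fact
        fix M3 t3 assume t3: "t3 \<le> t2 + 18 * p + 3" and F': "frame {0, 23, 24, 26, 27, 28} M2 M3"
        have F: "frame {0, 15, 23, 24, 25, 26, 27, 28, 29} M' M3"
          using F2 F' by (simp add: frame_def)
        have S3: "static M3" by (rule static_frame[OF conjunct1[OF I] F]) auto
        have solved3: "solved 0 M3" by (rule solved_frame[OF _ F]) (use I in auto)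
        have regs3: "M3 10 = i" "M3 11 = j" "M3 12 = x" "M3 13 = idx i j x" "arr 6 M3 = arr 6 M'"
          "M3 6 = (p + 2) * 2 ^ (2 * k)"
          using frame_get[OF F] frame_arr[OF F] regs st by simp_all
        show "?tail M3 inp (out' @ concat (map (\<lambda>q. [M2 29, q]) (diffs (i + b) j))) t3"
          using S3 solved3 tr' idx t3 t2 I ij
          by (simp add: wp_simps regs3 M2 One_nat_def)
      qed
      then show ?thesis
        using 2(2) by (simp add: trace_step_def wp_simps regs st One_nat_def)
    qed
    then show "holds M' (Less (Cell 13) (Cell 9)) \<and> wp trace_step (?I (Suc n)) M' inp' out' (t' + 1)"
      using I idx_less_sink[OF b(1) j b(2)] by (simp add: regs st)
  next
    fix M' inp' out' t'
    assume I: "?I (m + p + 1) M' inp' out' t'"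
    then obtain i j x where regs: "M' 13 = idx i j x"
      and ij: "i + j = m + p + 1" and tr: "traced out' i j x" by blast
    then have ij': "i = m" "j = Suc p" by (auto simp: traced_def)
    with tr opt_beyond[of i j x] have x: "x = 2 ^ k - 1" "opt i j x = 1"
      by (auto simp: traced_def split: if_splits)
    from tr obtain T where T: "out' = flatten (edits T)" "total T + opt i j x = opt 0 0 (2 ^ k - 1)"
      "\<forall>T'. completes i j x T' \<longrightarrow> completes 0 0 (2 ^ k - 1) (T @ T')" unfolding traced_def by blast
    then have "out' = flatten (edits T)" "completes 0 0 (2 ^ k - 1) T"
      "opt 0 0 (2 ^ k - 1) = Suc (total T)" using x ij' T(3)[rule_format, of "[]"] by auto
    then have "Q M' inp out' (t' + 1)"
      using I by (auto simp: trace_time_def intro!: Q)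
    moreover have "M' 9 = idx m (Suc p) (2 ^ k - 1)" using I by (simp add: static_def)
    ultimately show "\<not> holds M' (Less (Cell 13) (Cell 9)) \<and> Q M' inp' out' (t' + 1)"
      using I regs ij' x by simp
  qed
  have "traced [] 0 0 (2 ^ k - 1)"
    using nz mask by (auto simp: traced_def flatten_def edits_def total_def intro!: exI[of _ "[]"])
  then show ?thesis
    using S by (auto simp: trace_def wp_Seq wp_Move M7 idx_def intro!: loop)
qed

end

section \<open>Reading the input\<close>

text \<open>Cell 12 accumulates multiples of \<open>p\<close> and so supplies the row offsets; it
  ends at \<open>m * p\<close>, the length of the matrix that is read later.\<close>

definition read_students :: program where
  "read_students = While (Less (Cell 10) (Cell 2)) (block
     [Read (To_Cell 14),
      Add (To_Cell 14) (Cell 14) (Cell 4),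
      Sub (To_Cell 14) (Cell 14) (Const 1),
      store 0 14 10,
      store 7 14 12,
      Add (To_Cell 12) (Cell 12) (Cell 3),
      Add (To_Cell 10) (Cell 10) (Const 1)])"

definition read_array :: "nat \<Rightarrow> nat \<Rightarrow> nat \<Rightarrow> program" where
  "read_array a r l = While (Less (Cell r) (Cell l)) (block
     [Read (To_Cell 14),
      store a r 14,
      Add (To_Cell r) (Cell r) (Const 1)])"

text \<open>The time is linear in the content of \<open>l\<close>, so the small factors
  \<open>p + 2\<close> and \<open>m + 1\<close> go there and not the power of 4.\<close>

definition multiply :: "nat \<Rightarrow> nat \<Rightarrow> nat \<Rightarrow> program" where
  "multiply r a l = block
     [Move (To_Cell r) (Const 0),
      Move (To_Cell 15) (Const 0),
      While (Less (Cell 15) (Cell l)) (block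
        [Add (To_Cell r) (Cell r) (Cell a),
         Add (To_Cell 15) (Cell 15) (Const 1)])]"

definition powers :: program where
  "powers = block
     [Move (To_Cell 5) (Const 1),
      Move (To_Cell 7) (Const 1),
      Move (To_Cell 8) (Const 0),
      While (Less (Cell 8) (Cell 4)) (block
        [Add (To_Cell 5) (Cell 5) (Cell 5),
         Add (To_Cell 5) (Cell 5) (Cell 5),
         Add (To_Cell 7) (Cell 7) (Cell 7),
         Add (To_Cell 8) (Cell 8) (Const 1)])]"

text \<open>The final store enters the only nonzero border value: the final node with cost 0,
  shifted to 1.\<close>

definition init_tables :: program where
  "init_tables = block
     [powers,
      Sub (To_Cell 7) (Cell 7) (Const 1),
      Add (To_Cell 8) (Cell 8) (Cell 8),
      Add (To_Cell 8) (Cell 8) (Const 1),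
      Add (To_Cell 14) (Cell 3) (Const 2),
      multiply 6 5 14,
      Add (To_Cell 10) (Cell 2) (Const 1),
      multiply 13 6 10,
      Sub (To_Cell 9) (Cell 13) (Cell 5),
      Add (To_Cell 9) (Cell 9) (Cell 7),
      Move (To_Cell 14) (Const 1),
      store 4 9 14]"

definition prepare :: program where
  "prepare = block
     [Read (To_Cell 2),
      Read (To_Cell 3),
      Read (To_Cell 4),
      read_students,
      read_array 2 11 3,
      read_array 3 13 12,
      init_tables]"

section \<open>Correctness of the arithmetic and of reading the input\<close>

lemma wp_multiply:
  assumes "distinct [r, a, l, 15]"
    and Q: "\<And>t'. t' \<le> t + 3 * M l + 3 \<Longrightarrow> Q (M(r := M l * M a, 15 := M l)) inp out t'"
  shows "wp (multiply r a l) Q M inp out t"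
proof -
  let ?M = "\<lambda>n. M(r := n * M a, 15 := n)"
  let ?I = "\<lambda>n M' inp' out' t'. M' = ?M n \<and> inp' = inp \<and> out' = out \<and> t' \<le> t + 2 + 3 * n"
  have neq: "r \<noteq> a" "r \<noteq> l" "r \<noteq> 15" "a \<noteq> 15" "l \<noteq> 15" "a \<noteq> r" "l \<noteq> r" "15 \<noteq> r" using assms(1) by auto
  show ?thesis
    unfolding multiply_def block.simps wp_Seq wp_Move
  proof (rule wp_loop[where n = "M l" and I = ?I])
    fix n M' inp' out' t'
    assume n: "n < M l" and I: "?I n M' inp' out' t'"
    have "(?M n)(r := n * M a + M a, 15 := Suc n) = ?M (Suc n)" by (auto simp: fun_eq_iff)
    then show "holds M' (Less (Cell 15) (Cell l)) \<and> wp (Seq (Add (To_Cell r) (Cell r) (Cell a))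
        (Add (To_Cell 15) (Cell 15) (Const 1))) (?I (Suc n)) M' inp' out' (t' + 1)"
      using n I neq by (simp add: wp_simps One_nat_def)
  next
    fix M' inp' out' t'
    assume I: "?I (M l) M' inp' out' t'"
    have "Q (?M (M l)) inp out (t' + 1)" by (rule Q) (use I in simp)
    then show "\<not> holds M' (Less (Cell 15) (Cell l)) \<and> Q M' inp' out' (t' + 1)" using I neq by simp
  qed (use neq in \<open>simp add: fun_eq_iff\<close>)
qed

lemma wp_powers:
  assumes Q: "\<And>t'. t' \<le> t + 5 * M 4 + 4 \<Longrightarrow>
      Q (M(5 := 2 ^ (2 * M 4), 7 := 2 ^ M 4, 8 := M 4)) inp out t'"
  shows "wp powers Q M inp out t"
proof -
  let ?M = "\<lambda>n. M(5 := 2 ^ (2 * n), 7 := 2 ^ n, 8 := n)"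
  let ?I = "\<lambda>n M' inp' out' t'. M' = ?M n \<and> inp' = inp \<and> out' = out \<and> t' \<le> t + 3 + 5 * n"
  show ?thesis
    unfolding powers_def block.simps wp_Seq wp_Move
  proof (rule wp_loop[where n = "M 4" and I = ?I])
    fix n M' inp' out' t'
    assume n: "n < M 4" and I: "?I n M' inp' out' t'"
    let ?P = "(2::nat) ^ (2 * n)"
    have "?M (Suc n) = (?M n)(5 := ?P + ?P + (?P + ?P), 7 := 2 ^ n + 2 ^ n, 8 := Suc n)"
      by (auto simp: fun_eq_iff)
    moreover have "(?M n)(5 := ?P + ?P, 5 := ?P + ?P + (?P + ?P), 7 := 2 ^ n + 2 ^ n, 8 := Suc n) =
      (?M n)(5 := ?P + ?P + (?P + ?P), 7 := 2 ^ n + 2 ^ n, 8 := Suc n)" by (simp only: fun_upd_upd)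
    ultimately show "holds M' (Less (Cell 8) (Cell 4)) \<and> wp (Seq (Add (To_Cell 5) (Cell 5) (Cell 5))
        (Seq (Add (To_Cell 5) (Cell 5) (Cell 5)) (Seq (Add (To_Cell 7) (Cell 7) (Cell 7))
          (Add (To_Cell 8) (Cell 8) (Const 1))))) (?I (Suc n)) M' inp' out' (t' + 1)"
      using n I by (auto simp: wp_simps One_nat_def fun_eq_iff)
  next
    fix M' inp' out' t'
    assume I: "?I (M 4) M' inp' out' t'"
    have "Q (?M (M 4)) inp out (t' + 1)" by (rule Q) (use I in simp)
    then show "\<not> holds M' (Less (Cell 8) (Cell 4)) \<and> Q M' inp' out' (t' + 1)" using I by simp
  qed (simp add: fun_eq_iff)
qed

lemma wp_read_array:
  assumes "a < 8" "r \<in> {2..<32}" "l \<in> {2..<32}" "r \<noteq> 14" "l \<noteq> 14" "r \<noteq> l" "M r = 0" "M l = n"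
    and Q: "\<And>M' t'. t' \<le> t + 8 * n + 1 \<Longrightarrow> (\<forall>s<32. s \<notin> {0, 14, r} \<longrightarrow> M' s = M s) \<Longrightarrow>
      (\<forall>a'<8. a' \<noteq> a \<longrightarrow> arr a' M' = arr a' M) \<Longrightarrow> (\<forall>e<n. arr a M' e = f e) \<Longrightarrow> Q M' rest out t'"
  shows "wp (read_array a r l) Q M (map f [0..<n] @ rest) out t"
proof -
  let ?I = "\<lambda>i M' inp' out' t'. (\<forall>s<32. s \<notin> {0, 14, r} \<longrightarrow> M' s = M s) \<and> M' r = i \<and>
    (\<forall>a'<8. a' \<noteq> a \<longrightarrow> arr a' M' = arr a' M) \<and> (\<forall>e<i. arr a M' e = f e) \<and>
    inp' = map f [i..<n] @ rest \<and> out' = out \<and> t' \<le> t + 8 * i"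
  show ?thesis
    unfolding read_array_def
  proof (rule wp_loop[where n = n and I = ?I])
    show "?I 0 M (map f [0..<n] @ rest) out t" using assms by simp
  next
    fix i M' inp' out' t'
    assume i: "i < n" and I: "?I i M' inp' out' t'"
    have "M' l = n" using I assms by auto
    then show "holds M' (Less (Cell r) (Cell l)) \<and> wp (block
       [Read (To_Cell 14), store a r 14, Add (To_Cell r) (Cell r) (Const 1)]) (?I (Suc i)) M' inp' out' (t' + 1)"
      using i I assms(1-6) by (auto simp: wp_simps upt_conv_Cons less_Suc_eq)
  next
    fix M' inp' out' t'
    assume I: "?I n M' inp' out' t'"
    have "M' l = n" using I assms by auto
    moreover have "Q M' rest out (t' + 1)" by (rule Q) (use I in auto)
    ultimately show "\<not> holds M' (Less (Cell r) (Cell l)) \<and> Q M' inp' out' (t' + 1)" using I by simp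
  qed
qed

lemma wp_read_students:
  assumes \<alpha>: "inj_on \<alpha> {..<m}" "\<And>s. s < m \<Longrightarrow> 1 \<le> \<alpha> s"
    and M: "M 2 = m" "M 3 = p" "M 4 = k" "M 10 = 0" "M 12 = 0"
    and Q: "\<And>M' t'. t' \<le> t + 16 * m + 1 \<Longrightarrow> (\<forall>s<32. s \<notin> {0, 10, 12, 14} \<longrightarrow> M' s = M s) \<Longrightarrow>
      M' 12 = m * p \<Longrightarrow> (\<forall>a<8. a \<notin> {0, 7} \<longrightarrow> arr a M' = arr a M) \<Longrightarrow>
      (\<forall>s<m. arr 0 M' (\<alpha> s + k - 1) = s \<and> arr 7 M' (\<alpha> s + k - 1) = s * p) \<Longrightarrow> Q M' rest out t'"
  shows "wp read_students Q M (map \<alpha> [0..<m] @ rest) out t"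
proof -
  let ?I = "\<lambda>i M' inp' out' t'. (\<forall>s<32. s \<notin> {0, 10, 12, 14} \<longrightarrow> M' s = M s) \<and> M' 10 = i \<and> M' 12 = i * p \<and>
    (\<forall>a<8. a \<notin> {0, 7} \<longrightarrow> arr a M' = arr a M) \<and>
    (\<forall>s<i. arr 0 M' (\<alpha> s + k - 1) = s \<and> arr 7 M' (\<alpha> s + k - 1) = s * p) \<and>
    inp' = map \<alpha> [i..<m] @ rest \<and> out' = out \<and> t' \<le> t + 16 * i"
  show ?thesis
    unfolding read_students_def
  proof (rule wp_loop[where n = m and I = ?I])
    show "?I 0 M (map \<alpha> [0..<m] @ rest) out t" using M by simp
  next
    fix i M' inp' out' t'
    assume i: "i < m" and I: "?I i M' inp' out' t'"
    have regs: "M' 2 = m" "M' 3 = p" "M' 4 = k" using I M by auto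
    \<comment> \<open>Later stores must not overwrite the entries of earlier students;
      \<open>1 \<le> \<alpha> s\<close> keeps the truncated subtraction injective.\<close>
    have neq: "\<alpha> s + k - 1 \<noteq> \<alpha> i + k - 1" if "s < i" for s
    proof -
      have "\<alpha> s \<noteq> \<alpha> i" using inj_onD[OF \<alpha>(1), of s i] that i by auto
      moreover have "1 \<le> \<alpha> s" "1 \<le> \<alpha> i" using \<alpha>(2) that i by auto
      ultimately show ?thesis by arith
    qed
    show "holds M' (Less (Cell 10) (Cell 2)) \<and> wp (block
     [Read (To_Cell 14),
      Add (To_Cell 14) (Cell 14) (Cell 4),
      Sub (To_Cell 14) (Cell 14) (Const 1),
      store 0 14 10,
      store 7 14 12,
      Add (To_Cell 12) (Cell 12) (Cell 3),
      Add (To_Cell 10) (Cell 10) (Const 1)]) (?I (Suc i)) M' inp' out' (t' + 1)"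
      using i I neq regs by (auto simp: wp_simps upt_conv_Cons less_Suc_eq)
  next
    fix M' inp' out' t'
    assume I: "?I m M' inp' out' t'"
    have "M' 2 = m" using I M by auto
    moreover have "Q M' rest out (t' + 1)" by (rule Q) (use I in auto)
    ultimately show "\<not> holds M' (Less (Cell 10) (Cell 2)) \<and> Q M' inp' out' (t' + 1)" using I by simp
  qed
qed

lemma concat_rows:
  "concat (map (\<lambda>s. map (f s) [0..<p]) [0..<m]) = map (\<lambda>e. f (e div p) (e mod p)) [0..<m * p]"
proof (induction m)
  case (Suc m)
  have "map (\<lambda>e. f (e div p) (e mod p)) [m * p..<m * p + p] = map (f m) [0..<p]"
    by (rule nth_equalityI) auto
  moreover have "[0..<Suc m * p] = [0..<m * p] @ [m * p..<m * p + p]"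
    using upt_add_eq_append[of 0 "m * p" p] by (simp add: add.commute)
  ultimately show ?case using Suc by simp
qed simp

context tables
begin

definition ready :: "memory \<Rightarrow> bool" where
  "ready M \<longleftrightarrow> static M \<and> solved (idx (Suc m) 0 0) M \<and> M 10 = Suc m \<and> M 13 = idx (Suc m) 0 0"

text \<open>The threshold lies above all interior nodes, so only the border has to be right, and
  \<open>opt_beyond\<close> describes it completely.\<close>

lemma solved_init:
  assumes "arr 4 M = (\<lambda>_. 0)(idx m (Suc p) (2 ^ k - 1) := 1)" and mask: "2 ^ k - 1 < (2::nat) ^ (2 * k)"
  shows "solved (idx (Suc m) 0 0) M"
  unfolding solved_def
proof (intro allI impI)
  fix i j x :: nat assume ij: "i \<le> Suc m" "j \<le> Suc p" and x: "x < 2 ^ (2 * k)"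
  have le: "idx m (Suc p) 0 \<le> idx (Suc m) 0 0" by (simp add: idx_def algebra_simps)
  show "(m < i \<or> p < j \<or> idx (Suc m) 0 0 \<le> idx i j x \<longrightarrow> arr 4 M (idx i j x) = opt i j x) \<and>
    (i \<le> m \<and> j \<le> p \<and> idx (Suc m) 0 0 \<le> idx i j x \<longrightarrow>
      best_upto i j x (2 * k + 1) (opt i j x) (arr 5 M (idx i j x)) (arr 6 M (idx i j x)))"
  proof (cases "i \<le> m \<and> j \<le> p")
    case True
    then have "idx i j x < idx m (Suc p) 0" using x by (intro idx_less_sink) auto
    then show ?thesis using True le by simp
  next
    case False
    then have *: "i = Suc m \<or> j = Suc p" using ij by auto
    have "idx i j x = idx m (Suc p) (2 ^ k - 1) \<longleftrightarrow> i = m \<and> j = Suc p \<and> x = 2 ^ k - 1"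
      using ij x mask by (intro idx_inject) auto
    then show ?thesis using opt_beyond[OF *, of x] * by (auto simp: assms(1))
  qed
qed

end

definition prepare_time :: "nat \<Rightarrow> nat \<Rightarrow> nat \<Rightarrow> nat" where
  "prepare_time m p k = 19 * m + 11 * p + 8 * (m * p) + 5 * k + 60"

text \<open>The locale parameters become the arrays found in memory after reading, whatever these
  contain outside the slots of students; hence they depend on \<open>M\<close>.\<close>

lemma wp_prepare:
  assumes inst: "near_chain_instance {..<m} {..<p} E \<alpha> \<beta> k"
    and Q: "\<And>M t. t \<le> prepare_time m p k \<Longrightarrow> near_chain m p k (arr 0 M) (arr 7 M) \<beta> (arr 3 M) E \<alpha> \<Longrightarrow>
      tables.ready m p k (arr 0 M) (arr 7 M) \<beta> (arr 3 M) M \<Longrightarrow> Q M [] [] t"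
  shows "wp prepare Q (\<lambda>_. 0) (encode_input m p E \<alpha> \<beta> k) [] 0"
proof -
  let ?e = "\<lambda>e. of_bool ((e div p, e mod p) \<in> E) :: nat"
  have \<alpha>: "inj_on \<alpha> {..<m}" "\<And>s. s < m \<Longrightarrow> 1 \<le> \<alpha> s"
    using inst by (auto simp: near_chain_instance_def is_ordering_def bij_betw_def)
  have enc: "encode_input m p E \<alpha> \<beta> k = m # p # k # map \<alpha> [0..<m] @ map \<beta> [0..<p] @ map ?e [0..<m * p] @ []"
    by (simp add: encode_input_def concat_rows)
  have rest: "wp init_tables Q M [] [] t"
    if t: "t \<le> 16 * m + 8 * p + 8 * (m * p) + 6"
      and regs: "M 2 = m" "M 3 = p" "M 4 = k"
      and arrs: "\<forall>s<m. arr 0 M (\<alpha> s + k - 1) = s \<and> arr 7 M (\<alpha> s + k - 1) = s * p"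
        "\<forall>q<p. arr 2 M q = \<beta> q" "\<forall>e<m * p. arr 3 M e = ?e e" "arr 4 M = (\<lambda>_. 0)" for M t
  proof -
    interpret near_chain m p k "arr 0 M" "arr 7 M" \<beta> "arr 3 M" E \<alpha>
    proof
      fix s q assume s: "s < m" and q: "q < p"
      have "s * p + q < Suc s * p" using q by simp
      also have "\<dots> \<le> m * p" using s by (intro mult_le_mono1) simp
      finally show "arr 3 M (s * p + q) = of_bool ((s, q) \<in> E)" using arrs(3) q by simp
    qed (use inst arrs in auto)
    have "(2::nat) ^ k \<le> 2 ^ (2 * k)" by (intro power_increasing) auto
    then have mask: "2 ^ k - 1 < (2::nat) ^ (2 * k)"
      by (metis diff_less less_le_trans less_numeral_extra(1) zero_less_numeral zero_less_power)
    let ?W = "2 ^ (2 * k) :: nat"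
    have sum: "idx (Suc m) 0 0 = idx m (Suc p) 0 + ?W" by (simp add: idx_def algebra_simps)
    have prod: "(m + 1) * (?W + (?W + p * ?W)) = idx (Suc m) 0 0"
      by (simp add: idx_def algebra_simps)
    have sink: "idx (Suc m) 0 0 - ?W + 2 ^ k - 1 = idx m (Suc p) (2 ^ k - 1)"
      unfolding sum by (simp add: idx_def)
    have fin: "Q M' [] [] t'"
      if t': "t' \<le> prepare_time m p k"
        and regs': "M' 2 = m" "M' 3 = p" "M' 4 = k" "M' 5 = 2 ^ (2 * k)" "M' 6 = (p + 2) * 2 ^ (2 * k)"
          "M' 7 = 2 ^ k - 1" "M' 8 = 2 * k + 1" "M' 9 = idx m (Suc p) (2 ^ k - 1)"
          "M' 10 = Suc m" "M' 13 = idx (Suc m) 0 0"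
        and arrs': "arr 0 M' = arr 0 M" "arr 7 M' = arr 7 M" "arr 2 M' = arr 2 M" "arr 3 M' = arr 3 M"
          "arr 4 M' = (arr 4 M)(idx m (Suc p) (2 ^ k - 1) := 1)" for M' t'
    proof (rule Q[OF t'])
      show "near_chain m p k (arr 0 M') (arr 7 M') \<beta> (arr 3 M') E \<alpha>"
        unfolding arrs' by unfold_locales
      have "static M'" using regs' arrs' arrs(2) by (simp add: static_def)
      moreover have "solved (idx (Suc m) 0 0) M'"
        by (rule solved_init[OF _ mask]) (use arrs' arrs(4) in simp)
      ultimately show "tables.ready m p k (arr 0 M') (arr 7 M') \<beta> (arr 3 M') M'"
        using regs' unfolding arrs' by (simp add: ready_def)
    qed
    show ?thesis
      unfolding init_tables_def block.simps wp_Seq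
    proof (rule wp_powers)
      fix t1 assume t1: "t1 \<le> t + 5 * M 4 + 4"
      have "wp (multiply 6 5 14) (wp (Add (To_Cell 10) (Cell 2) (Const 1))
          (wp (multiply 13 6 10) (wp (Sub (To_Cell 9) (Cell 13) (Cell 5))
          (wp (Add (To_Cell 9) (Cell 9) (Cell 7)) (wp (Move (To_Cell 14) (Const 1))
          (wp (store 4 9 14) Q)))))) M1 [] [] t2"
        if M1: "M1 = M(5 := ?W, 7 := 2 ^ k - 1, 8 := k + k + 1, 14 := p + 2)" and t2: "t2 \<le> t1 + 4"
        for M1 t2
      proof (rule wp_multiply)
        fix t3 assume t3: "t3 \<le> t2 + 3 * M1 14 + 3"
        let ?M2 = "M1(6 := M1 14 * M1 5, 15 := M1 14, 10 := m + 1)"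
        have "wp (multiply 13 6 10) (wp (Sub (To_Cell 9) (Cell 13) (Cell 5))
          (wp (Add (To_Cell 9) (Cell 9) (Cell 7)) (wp (Move (To_Cell 14) (Const 1))
          (wp (store 4 9 14) Q)))) ?M2 [] [] (t3 + 1)"
        proof (rule wp_multiply)
          fix t4 assume t4: "t4 \<le> t3 + 1 + 3 * ?M2 10 + 3"
          show "wp (Sub (To_Cell 9) (Cell 13) (Cell 5))
            (wp (Add (To_Cell 9) (Cell 9) (Cell 7)) (wp (Move (To_Cell 14) (Const 1))
            (wp (store 4 9 14) Q))) (?M2(13 := ?M2 10 * ?M2 6, 15 := ?M2 10)) [] [] t4"
            using t t1 t2 t3 t4
            by (simp add: wp_simps M1 regs prod)
              (rule fin, simp_all add: regs prod sink prepare_time_def)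
        qed simp
        then show "wp (Add (To_Cell 10) (Cell 2) (Const 1))
          (wp (multiply 13 6 10) (wp (Sub (To_Cell 9) (Cell 13) (Cell 5))
          (wp (Add (To_Cell 9) (Cell 9) (Cell 7)) (wp (Move (To_Cell 14) (Const 1))
          (wp (store 4 9 14) Q))))) (M1(6 := M1 14 * M1 5, 15 := M1 14)) [] [] t3"
          using regs by (simp add: wp_Add M1)
      qed simp
      note * = this
      show "wp (Sub (To_Cell 7) (Cell 7) (Const 1)) (wp (Add (To_Cell 8) (Cell 8) (Cell 8))
          (wp (Add (To_Cell 8) (Cell 8) (Const 1)) (wp (Add (To_Cell 14) (Cell 3) (Const 2))
          (wp (multiply 6 5 14) (wp (Add (To_Cell 10) (Cell 2) (Const 1))
          (wp (multiply 13 6 10) (wp (Sub (To_Cell 9) (Cell 13) (Cell 5))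
          (wp (Add (To_Cell 9) (Cell 9) (Cell 7)) (wp (Move (To_Cell 14) (Const 1))
          (wp (store 4 9 14) Q))))))))))
          (M(5 := 2 ^ (2 * M 4), 7 := 2 ^ M 4, 8 := M 4)) [] [] t1"
        using *[OF refl, of "t1 + 1 + 1 + 1 + 1"] by (simp add: wp_simps regs)
    qed
  qed
  let ?M0 = "(\<lambda>_. 0)(2 := m, 3 := p, 4 := k) :: memory"
  have "wp read_students (wp (read_array 2 11 3) (wp (read_array 3 13 12) (wp init_tables Q)))
      ?M0 (map \<alpha> [0..<m] @ map \<beta> [0..<p] @ map ?e [0..<m * p] @ []) [] 3"
  proof (rule wp_read_students[OF \<alpha>, where k = k and p = p])
    fix M1 t1
    assume 1: "t1 \<le> 3 + 16 * m + 1" "\<forall>s<32. s \<notin> {0, 10, 12, 14} \<longrightarrow> M1 s = ?M0 s" "M1 12 = m * p"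
      "\<forall>a<8. a \<notin> {0, 7} \<longrightarrow> arr a M1 = arr a ?M0"
      "\<forall>s<m. arr 0 M1 (\<alpha> s + k - 1) = s \<and> arr 7 M1 (\<alpha> s + k - 1) = s * p"
    show "wp (read_array 2 11 3) (wp (read_array 3 13 12) (wp init_tables Q))
      M1 (map \<beta> [0..<p] @ map ?e [0..<m * p] @ []) [] t1"
    proof (rule wp_read_array)
      fix M2 t2
      assume 2: "t2 \<le> t1 + 8 * p + 1" "\<forall>s<32. s \<notin> {0, 14, 11} \<longrightarrow> M2 s = M1 s"
        "\<forall>a'<8. a' \<noteq> 2 \<longrightarrow> arr a' M2 = arr a' M1" "\<forall>e<p. arr 2 M2 e = \<beta> e"
      show "wp (read_array 3 13 12) (wp init_tables Q) M2 (map ?e [0..<m * p] @ []) [] t2"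
      proof (rule wp_read_array)
        fix M3 t3
        assume 3: "t3 \<le> t2 + 8 * (m * p) + 1" "\<forall>s<32. s \<notin> {0, 14, 13} \<longrightarrow> M3 s = M2 s"
          "\<forall>a'<8. a' \<noteq> 3 \<longrightarrow> arr a' M3 = arr a' M2" "\<forall>e<m * p. arr 3 M3 e = ?e e"
        have "arr 4 ?M0 = (\<lambda>_. 0)" by (simp add: arr_def fun_eq_iff)
        then show "wp init_tables Q M3 [] [] t3"
          using 1 2 3 by (intro rest) simp_all
      qed (use 1 2 in simp_all)
    qed (use 1 in simp_all)
  qed simp_all
  then show ?thesis
    unfolding prepare_def block.simps wp_Seq by (simp add: wp_Read enc)
qed

section \<open>The running time\<close>

definition solver :: program where
  "solver = block [prepare, sweep, trace]"

text \<open>From \<open>k = 4\<close> on, 16^k = 4^(2k) is at most k^(2k); below that, 4096 = 16^3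
  suffices.\<close>

lemma sixteen_power_le:
  assumes "0 < k"
  shows "(16::nat) ^ k \<le> 4096 * k ^ (2 * k)"
proof (cases "4 \<le> k")
  case True
  have "(16::nat) ^ k = 4 ^ (2 * k)" by (simp add: power_mult)
  also have "\<dots> \<le> k ^ (2 * k)" using True by (rule power_mono) simp
  finally show ?thesis by simp
next
  case False
  then have "(16::nat) ^ k \<le> 16 ^ 3" by (intro power_increasing) auto
  also have "\<dots> \<le> 4096 * k ^ (2 * k)" using assms by simp
  finally show ?thesis .
qed

context tables
begin

definition solver_time :: nat where
  "solver_time = prepare_time m p k + (Suc m * (Suc p * (row_time + 4) + 5) + 1) + trace_time"

text \<open>\<open>Z\<close> majorizes every phase: \<open>a * c * W\<close> bounds the nodes up to
  constants, each has O(\<open>k\<close>) offsets, and \<open>W * c\<close> bounds the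
  O(\<open>W\<close> + \<open>p\<close>) steps per offset. The constant is 381 * 8 * 4096.\<close>

lemma solver_time_le:
  assumes "0 < k" "0 < m + p"
  shows "solver_time \<le> 12484608 * ((m + p) ^ 3 * k ^ (2 * k + 2))"
proof -
  define a where "a = Suc m"
  define c where "c = Suc p"
  define W :: nat where "W = 2 ^ (2 * k)"
  define Z where "Z = a * c ^ 2 * k * W ^ 2"
  have pos: "1 \<le> a" "1 \<le> c" "1 \<le> W" "1 \<le> k" using assms by (auto simp: a_def c_def W_def)
  have Z_ge: "u * v ^ 2 * w * x ^ 2 \<le> Z" if "u \<le> a" "v \<le> c" "w \<le> k" "x \<le> W" for u v w x
    unfolding Z_def using that by (intro mult_le_mono power_mono) auto
  \<comment> \<open>220 = 3 * 60 + 40, where the additive 40 is absorbed because the product is at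
    least 1.\<close>
  have node: "node_time \<le> 220 * (k * W * c)"
  proof -
    have "9 * W + 18 * p + 51 \<le> 9 * (W * c) + 51 * (W * c)"
      using mult_le_mono2[of 1 c W] mult_le_mono1[of 1 W c] pos by (simp add: c_def)
    then have "(2 * k + 1) * (9 * W + 18 * p + 51) \<le> 3 * k * (60 * (W * c))"
      using pos by (intro mult_le_mono) auto
    moreover have "1 * 1 * 1 \<le> k * W * c" using pos by (intro mult_le_mono)
    ultimately show ?thesis by (simp add: node_time_def W_def[symmetric])
  qed
  have row: "row_time + 4 \<le> 227 * (k * W ^ 2 * c)"
  proof -
    have "1 * 1 * 1 \<le> k * W * c" using pos by (intro mult_le_mono)
    with node have "W * (node_time + 3) \<le> W * (223 * (k * W * c))" by (intro mult_le_mono2) simp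
    moreover have "1 * 1 ^ 2 * 1 \<le> k * W ^ 2 * c" using pos by (intro mult_le_mono power_mono) auto
    ultimately show ?thesis
      unfolding row_time_def W_def[symmetric] by (simp add: power2_eq_square algebra_simps)
  qed
  have "Suc m * (Suc p * (row_time + 4) + 5) \<le> 232 * Z"
  proof -
    have "c * (row_time + 4) \<le> c * (227 * (k * W ^ 2 * c))" using row by (rule mult_le_mono2)
    then have "a * (c * (row_time + 4)) \<le> 227 * Z"
      using mult_le_mono2[of "c * (row_time + 4)" "c * (227 * (k * W ^ 2 * c))" a]
      by (simp add: Z_def power2_eq_square algebra_simps)
    moreover have "a \<le> Z" using Z_ge[of a 1 1 1] pos by simp
    ultimately show ?thesis by (simp add: a_def[symmetric] c_def[symmetric] algebra_simps)
  qed
  moreover have "prepare_time m p k \<le> 103 * Z"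
  proof -
    have "a \<le> Z" "k \<le> Z" "1 \<le> Z" using Z_ge[of a 1 1 1] Z_ge[of 1 1 k 1] Z_ge[of 1 1 1 1] pos by simp_all
    moreover have "a * c ^ 2 \<le> Z" using Z_ge[of a c 1 1] pos by simp
    moreover have "c \<le> a * c ^ 2" "m * p \<le> a * c ^ 2"
      by (simp_all add: a_def c_def power2_eq_square algebra_simps)
    ultimately show ?thesis by (simp add: prepare_time_def a_def c_def)
  qed
  moreover have "trace_time \<le> 45 * Z"
  proof -
    have "m + p + 1 \<le> a * c" "18 * p + 40 \<le> 40 * c" by (simp_all add: a_def c_def)
    then have "(m + p + 1) * (18 * p + 40) \<le> a * c * (40 * c)" by (rule mult_le_mono)
    moreover have "a * c ^ 2 \<le> Z" "1 \<le> Z" using Z_ge[of a c 1 1] Z_ge[of 1 1 1 1] pos by simp_all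
    ultimately show ?thesis by (simp add: trace_time_def power2_eq_square)
  qed
  moreover have "1 \<le> Z" using Z_ge[of 1 1 1 1] pos by simp
  \<comment> \<open>381 = 232 + 103 + 45 + 1.\<close>
  ultimately have "solver_time \<le> 381 * Z" by (simp add: solver_time_def)
  also have "Z \<le> 8 * (m + p) ^ 3 * (4096 * k ^ (2 * k + 2))"
  proof -
    \<comment> \<open>Nonemptiness enters here: \<open>Suc m\<close> and \<open>Suc p\<close> are at
      most twice \<open>m + p\<close> once this sum is positive.\<close>
    have "a \<le> 2 * (m + p)" "c \<le> 2 * (m + p)" using assms(2) by (cases m; cases p; simp add: a_def c_def)+
    then have "a * c ^ 2 \<le> 2 * (m + p) * (2 * (m + p)) ^ 2" by (intro mult_le_mono power_mono) auto
    also have "\<dots> = 8 * (m + p) ^ 3" by (simp add: power3_eq_cube power2_eq_square algebra_simps)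
    finally have ac: "a * c ^ 2 \<le> 8 * (m + p) ^ 3" .
    have "W ^ 2 = 2 ^ (4 * k)" by (simp add: W_def flip: power_mult)
    also have "\<dots> = 16 ^ k" by (simp add: power_mult)
    finally have "W ^ 2 = 16 ^ k" .
    with sixteen_power_le[OF assms(1)] have "k * W ^ 2 \<le> k * (4096 * k ^ (2 * k))" by simp
    also have "\<dots> \<le> k ^ 2 * (4096 * k ^ (2 * k))"
      using pos by (intro mult_le_mono1) (simp add: power2_eq_square)
    also have "\<dots> = 4096 * k ^ (2 * k + 2)" by (simp add: power_add power2_eq_square)
    finally have "k * W ^ 2 \<le> 4096 * k ^ (2 * k + 2)" .
    from mult_le_mono[OF ac this] show ?thesis by (simp add: Z_def mult.assoc)
  qed
  finally show ?thesis by simp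
qed

end

lemma wp_solver:
  assumes inst: "near_chain_instance {..<m} {..<p} E \<alpha> \<beta> k"
  shows "wp solver (\<lambda>M inp out t. (\<exists>F. encodes_output out F \<and> near_chain_solution {..<m} {..<p} E \<alpha> \<beta> k F) \<and>
      (0 < m + p \<longrightarrow> t \<le> 12484608 * ((m + p) ^ 3 * k ^ (2 * k + 2))))
    (\<lambda>_. 0) (encode_input m p E \<alpha> \<beta> k) [] 0" (is "wp solver ?Q _ _ _ _")
  unfolding solver_def block.simps wp_Seq
proof (rule wp_prepare[OF inst])
  fix M t assume t: "t \<le> prepare_time m p k"
    and nc: "near_chain m p k (arr 0 M) (arr 7 M) \<beta> (arr 3 M) E \<alpha>"
    and ready: "tables.ready m p k (arr 0 M) (arr 7 M) \<beta> (arr 3 M) M"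
  interpret near_chain m p k "arr 0 M" "arr 7 M" \<beta> "arr 3 M" E \<alpha> by (rule nc)
  show "wp sweep (wp trace ?Q) M [] [] t"
  proof (rule wp_sweep)
    fix M' t' assume t': "t' \<le> t + Suc m * (Suc p * (row_time + 4) + 5) + 1"
      and S: "static M'" "solved 0 M'"
    show "wp trace ?Q M' [] [] t'"
    proof (rule wp_trace[OF S opt_start_nonzero])
      fix M'' t'' T assume t'': "t'' \<le> t' + trace_time"
        and T: "completes 0 0 (2 ^ k - 1) T" "opt 0 0 (2 ^ k - 1) = Suc (total T)"
      have "encodes_output (flatten (edits T)) (set (edits T))"
        using optimal_solution(2)[OF T] by (auto simp: encodes_output_def flatten_def)
      moreover have "t'' \<le> solver_time" using t t' t'' by (simp add: solver_time_def)
      ultimately show "?Q M'' [] (flatten (edits T)) t''"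
        using optimal_solution(1)[OF T] solver_time_le[OF k_pos] by (blast intro: order.trans)
    qed
  qed (use ready in \<open>auto simp: ready_def\<close>)
qed

theorem theorem1:
  shows "\<exists>(P :: program) (C :: nat).
    \<forall>(m :: nat) (p :: nat) (E :: (nat \<times> nat) set) (\<alpha> :: nat \<Rightarrow> nat) (\<beta> :: nat \<Rightarrow> nat) (k :: nat).
      near_chain_instance {..<m} {..<p} E \<alpha> \<beta> k \<longrightarrow>
      (\<exists>t out F.
         runs P (encode_input m p E \<alpha> \<beta> k) t out \<and>
         encodes_output out F \<and>
         near_chain_solution {..<m} {..<p} E \<alpha> \<beta> k F \<and>
         (m + p > 0 \<longrightarrow> t \<le> C * ((m + p) ^ 3 * k ^ (2 * k + 2))))"
proof (rule exI[of _ solver], rule exI[of _ 12484608], intro allI impI)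
  fix m p k :: nat and E :: "(nat \<times> nat) set" and \<alpha> \<beta> :: "nat \<Rightarrow> nat"
  assume "near_chain_instance {..<m} {..<p} E \<alpha> \<beta> k"
  from wp_solver[OF this] show "\<exists>t out F.
         runs solver (encode_input m p E \<alpha> \<beta> k) t out \<and>
         encodes_output out F \<and>
         near_chain_solution {..<m} {..<p} E \<alpha> \<beta> k F \<and>
         (m + p > 0 \<longrightarrow> t \<le> 12484608 * ((m + p) ^ 3 * k ^ (2 * k + 2)))"
    unfolding wp_def runs_def add_0 by blast
qed

end
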